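(* Under the standing hypotheses (H1)–(H6) below, the deficiency indices of the minimal relation $T_{\min}$ are equal and at most two: $$n(T_{\min}):=\dim\operatorname{ran}(T_{\min}-\mathrm{i})^\perp=\dim\operatorname{ran}(T_{\min}+\mathrm{i})^\perp\le 2.$$
   Context: Let $-\infty\le a<b\le\infty$ and $\varrho,\varsigma,\chi$ locally finite Borel measures on $(a,b)$ with: (H1) $\varrho$ positive; (H2) $\chi$ real-valued; (H3) $\varsigma$ real-valued with $\operatorname{supp}\varsigma=(a,b)$; (H4) $\varsigma(\{x\})\chi(\{x\})=\varsigma(\{x\})\varrho(\{x\})=0$ for all $x$; (H5) for every gap $(\alpha,\beta)$ of $\operatorname{supp}\varrho$ (open interval in the complement with $\alpha,\beta\in\operatorname{supp}\varrho$) and every $f\in\mathfrak{D}_\tau$ with $f(\alpha-)=f(\beta+)=0$ one has $f=0$ on $(\alpha,\beta)$; (H6) $\operatorname{supp}\varrho$ has more than one point. Notation: $\int_c^x h\,d\mu=\int_{[c,x)}h\,d\mu$ ($x>c$), $0$ ($x=c$), $-\int_{[x,c)}h\,d\mu$ ($x<c$); $AC_{loc}((a,b);\mu)$: functions $f(x)=f(c)+\int_c^x h\,d\mu$, $h=\frac{df}{d\mu}\in L^1_{loc}$. $\mathfrak{D}_\tau$: $f\in AC_{loc}((a,b);\varsigma)$ for which there is $F\in AC_{loc}((a,b);\varrho)$ with $F=-\frac{df}{d\varsigma}+\int_c^{\cdot}f\,d\chi$ $|\varsigma|$-a.e.; $\tau f:=\frac{dF}{d\varrho}$. In $L^2((a,b);\varrho)$: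 $T_{\max}=\{(f,\tau f): f\in\mathfrak{D}_\tau,\ f,\tau f\in L^2\}$, $T_0=\{(f,\tau f)\in T_{\max}: f\text{ has compact support in }(a,b)\}$, $T_{\min}=\overline{T_0}$. For a linear relation $T$ and $z\in\mathbb{C}$, $T-z=\{(f,g-zf):(f,g)\in T\}$ and $\operatorname{ran}(T)=\{g:\exists f,(f,g)\in T\}$. *)

theory Defs
  imports "HOL-Analysis.Analysis"
begin

definition Iab :: "ereal \<Rightarrow> ereal \<Rightarrow> real set" where
  "Iab a b = {x. a < ereal x \<and> ereal x < b}"

text \<open>A (positive) locally finite Borel measure on (a,b), represented as a Borel
  measure on the real line that is concentrated on (a,b) and finite on every
  compact subinterval of (a,b).\<close>
definition loc_finite :: "ereal \<Rightarrow> ereal \<Rightarrow> real measure \<Rightarrow> bool" where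
  "loc_finite a b M \<longleftrightarrow>
     sets M = sets borel \<and> emeasure M (UNIV - Iab a b) = 0 \<and>
     (\<forall>\<alpha> \<beta>. \<alpha> \<in> Iab a b \<longrightarrow> \<beta> \<in> Iab a b \<longrightarrow> emeasure M {\<alpha>..\<beta>} < \<infinity>)"

text \<open>A real-valued locally finite Borel measure on (a,b), given by its Jordan
  decomposition P - N (P, N positive, locally finite, mutually singular);
  its variation is P + N.\<close>
definition signed_lf :: "ereal \<Rightarrow> ereal \<Rightarrow> real measure \<Rightarrow> real measure \<Rightarrow> bool" where
  "signed_lf a b P N \<longleftrightarrow> loc_finite a b P \<and> loc_finite a b N \<and>
     (\<exists>A \<in> sets borel. emeasure P A = 0 \<and> emeasure N (UNIV - A) = 0)"

definition supp_pos :: "ereal \<Rightarrow> ereal \<Rightarrow> real measure \<Rightarrow> real set" where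
  "supp_pos a b M = {x \<in> Iab a b. \<forall>e>0. emeasure M {x - e<..<x + e} \<noteq> 0}"

definition supp_signed :: "ereal \<Rightarrow> ereal \<Rightarrow> real measure \<Rightarrow> real measure \<Rightarrow> real set" where
  "supp_signed a b P N = {x \<in> Iab a b. \<forall>e>0.
      emeasure P {x - e<..<x + e} \<noteq> 0 \<or> emeasure N {x - e<..<x + e} \<noteq> 0}"

definition oint :: "real measure \<Rightarrow> real \<Rightarrow> real \<Rightarrow> (real \<Rightarrow> complex) \<Rightarrow> complex" where
  "oint M c x h =
     (if c < x then set_lebesgue_integral M {c..<x} h
      else if x = c then 0
      else - set_lebesgue_integral M {x..<c} h)"

definition oint_s :: "real measure \<Rightarrow> real measure \<Rightarrow> real \<Rightarrow> real \<Rightarrow> (real \<Rightarrow> complex) \<Rightarrow> complex" where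
  "oint_s P N c x h = oint P c x h - oint N c x h"

definition loc_int :: "ereal \<Rightarrow> ereal \<Rightarrow> real measure \<Rightarrow> (real \<Rightarrow> complex) \<Rightarrow> bool" where
  "loc_int a b M h \<longleftrightarrow>
     (\<forall>\<alpha> \<beta>. \<alpha> \<in> Iab a b \<longrightarrow> \<beta> \<in> Iab a b \<longrightarrow> set_integrable M {\<alpha>..\<beta>} h)"

definition AC_pos :: "ereal \<Rightarrow> ereal \<Rightarrow> real measure \<Rightarrow> real \<Rightarrow> (real \<Rightarrow> complex) \<Rightarrow> (real \<Rightarrow> complex) \<Rightarrow> bool" where
  "AC_pos a b M c f h \<longleftrightarrow> loc_int a b M h \<and>
     (\<forall>x \<in> Iab a b. f x = f c + oint M c x h)"

definition AC_signed :: "ereal \<Rightarrow> ereal \<Rightarrow> real measure \<Rightarrow> real measure \<Rightarrow> real \<Rightarrow> (real \<Rightarrow> complex) \<Rightarrow> (real \<Rightarrow> complex) \<Rightarrow> bool" where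
  "AC_signed a b P N c f h \<longleftrightarrow> loc_int a b P h \<and> loc_int a b N h \<and>
     (\<forall>x \<in> Iab a b. f x = f c + oint_s P N c x h)"

text \<open>tau_rel ... f g: f belongs to D_tau and g is (a representative of) tau f.
  Here R = rho, SP - SN = varsigma, XP - XN = chi.  The density h plays the role of
  df/dvarsigma and g the role of dF/drho.\<close>
definition tau_rel ::
  "ereal \<Rightarrow> ereal \<Rightarrow> real measure \<Rightarrow> real measure \<Rightarrow> real measure \<Rightarrow> real measure \<Rightarrow> real measure
     \<Rightarrow> (real \<Rightarrow> complex) \<Rightarrow> (real \<Rightarrow> complex) \<Rightarrow> bool" where
  "tau_rel a b R SP SN XP XN f g \<longleftrightarrow>
     (\<exists>c \<in> Iab a b. \<exists>h F.
        AC_signed a b SP SN c f h \<and> AC_pos a b R c F g \<and>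
        (AE x in SP. x \<in> Iab a b \<longrightarrow> F x = - h x + oint_s XP XN c x f) \<and>
        (AE x in SN. x \<in> Iab a b \<longrightarrow> F x = - h x + oint_s XP XN c x f))"

definition in_Dtau ::
  "ereal \<Rightarrow> ereal \<Rightarrow> real measure \<Rightarrow> real measure \<Rightarrow> real measure \<Rightarrow> real measure \<Rightarrow> real measure
     \<Rightarrow> (real \<Rightarrow> complex) \<Rightarrow> bool" where
  "in_Dtau a b R SP SN XP XN f \<longleftrightarrow> (\<exists>g. tau_rel a b R SP SN XP XN f g)"

definition L2 :: "real measure \<Rightarrow> (real \<Rightarrow> complex) \<Rightarrow> bool" where
  "L2 M f \<longleftrightarrow> f \<in> borel_measurable M \<and> integrable M (\<lambda>x. (cmod (f x))\<^sup>2)"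

definition l2norm :: "real measure \<Rightarrow> (real \<Rightarrow> complex) \<Rightarrow> real" where
  "l2norm M f = sqrt (integral\<^sup>L M (\<lambda>x. (cmod (f x))\<^sup>2))"

definition l2inner :: "real measure \<Rightarrow> (real \<Rightarrow> complex) \<Rightarrow> (real \<Rightarrow> complex) \<Rightarrow> complex" where
  "l2inner M f g = integral\<^sup>L M (\<lambda>x. f x * cnj (g x))"

definition Tmax ::
  "ereal \<Rightarrow> ereal \<Rightarrow> real measure \<Rightarrow> real measure \<Rightarrow> real measure \<Rightarrow> real measure \<Rightarrow> real measure
     \<Rightarrow> ((real \<Rightarrow> complex) \<times> (real \<Rightarrow> complex)) set" where
  "Tmax a b R SP SN XP XN = {(f, g). tau_rel a b R SP SN XP XN f g \<and> L2 R f \<and> L2 R g}"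

definition T0 ::
  "ereal \<Rightarrow> ereal \<Rightarrow> real measure \<Rightarrow> real measure \<Rightarrow> real measure \<Rightarrow> real measure \<Rightarrow> real measure
     \<Rightarrow> ((real \<Rightarrow> complex) \<times> (real \<Rightarrow> complex)) set" where
  "T0 a b R SP SN XP XN = {(f, g) \<in> Tmax a b R SP SN XP XN.
      \<exists>\<alpha> \<in> Iab a b. \<exists>\<beta> \<in> Iab a b. \<forall>x \<in> Iab a b. x \<notin> {\<alpha>..\<beta>} \<longrightarrow> f x = 0}"

definition l2closure :: "real measure \<Rightarrow> ((real \<Rightarrow> complex) \<times> (real \<Rightarrow> complex)) set
     \<Rightarrow> ((real \<Rightarrow> complex) \<times> (real \<Rightarrow> complex)) set" where
  "l2closure M T = {(f, g). L2 M f \<and> L2 M g \<and>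
      (\<exists>fg :: nat \<Rightarrow> (real \<Rightarrow> complex) \<times> (real \<Rightarrow> complex). (\<forall>n. fg n \<in> T) \<and>
         (\<lambda>n. l2norm M (\<lambda>x. fst (fg n) x - f x)) \<longlonglongrightarrow> 0 \<and>
         (\<lambda>n. l2norm M (\<lambda>x. snd (fg n) x - g x)) \<longlonglongrightarrow> 0)}"

definition Tmin ::
  "ereal \<Rightarrow> ereal \<Rightarrow> real measure \<Rightarrow> real measure \<Rightarrow> real measure \<Rightarrow> real measure \<Rightarrow> real measure
     \<Rightarrow> ((real \<Rightarrow> complex) \<times> (real \<Rightarrow> complex)) set" where
  "Tmin a b R SP SN XP XN = l2closure R (T0 a b R SP SN XP XN)"

definition ran_shift :: "((real \<Rightarrow> complex) \<times> (real \<Rightarrow> complex)) set \<Rightarrow> complex \<Rightarrow> (real \<Rightarrow> complex) set" where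
  "ran_shift T z = {(\<lambda>x. g x - z * f x) | f g. (f, g) \<in> T}"

definition l2orth :: "real measure \<Rightarrow> (real \<Rightarrow> complex) set \<Rightarrow> (real \<Rightarrow> complex) set" where
  "l2orth M S = {u. L2 M u \<and> (\<forall>v \<in> S. l2inner M v u = 0)}"

text \<open>Dimension of a set of functions regarded in L^2(M) (i.e. modulo M-null functions):
  the supremum of the sizes of families in S that are linearly independent modulo
  M-a.e. equality.\<close>
definition l2dim :: "real measure \<Rightarrow> (real \<Rightarrow> complex) set \<Rightarrow> enat" where
  "l2dim M S = Sup {enat n | n. \<exists>us :: nat \<Rightarrow> real \<Rightarrow> complex. (\<forall>i<n. us i \<in> S) \<and>
      (\<forall>c :: nat \<Rightarrow> complex. (AE x in M. (\<Sum>i<n. c i * us i x) = 0) \<longrightarrow> (\<forall>i<n. c i = 0))}"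

definition defect :: "real measure \<Rightarrow> ((real \<Rightarrow> complex) \<times> (real \<Rightarrow> complex)) set \<Rightarrow> complex \<Rightarrow> enat" where
  "defect M T z = l2dim M (l2orth M (ran_shift T z))"

end

theory Submission
  imports Defs
begin

text \<open>
  On a compact interval all coefficients are densities of one finite measure \<open>\<mu>\<close>, so that
  \<open>(\<tau> - z) f = g\<close> with zero data at the left end point becomes a Volterra system for \<open>f\<close> and its
  quasi-derivative, solvable by Picard iteration. By (H4) the Lagrange identity has no atomic
  correction term: the solution vanishes at the right end point, and hence extends by zero to an
  element of \<open>T\<^sub>0\<close>, as soon as \<open>g\<close> is orthogonal to a fundamental system \<open>w\<^sub>1, w\<^sub>2\<close> of
  \<open>(\<tau> - z) w = 0\<close>. So every \<open>u\<close> orthogonal to the range of \<open>T\<^sub>m\<^sub>i\<^sub>n - z\<close> is, on each compact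
  interval, orthogonal to all such \<open>g\<close>, that is, a combination of the conjugates of \<open>w\<^sub>1, w\<^sub>2\<close>. Any
  three such \<open>u\<close> are therefore locally dependent, and a compactness argument makes
  the dependence global. Equality of the two indices is conjugation symmetry.
\<close>

section \<open>Cumulative integrals and the product rule\<close>

locale finite_borel = finite_measure M for M :: "real measure" +
  assumes sets_M [measurable_cong]: "sets M = sets borel"
begin

lemma space_M [simp]: "space M = UNIV"
  using sets_eq_imp_space_eq[OF sets_M] by simp

text \<open>The open upper end matches the convention of integrating over \<open>[c,x)\<close>: an
  atom at \<open>x\<close> is not yet counted.\<close>

definition cum :: "(real \<Rightarrow> 'a::{banach, second_countable_topology}) \<Rightarrow> real \<Rightarrow> 'a" where
  "cum f x = set_lebesgue_integral M {..<x} f"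

lemma set_integrable_M: "integrable M f \<Longrightarrow> A \<in> sets borel \<Longrightarrow> set_integrable M A f"
  for f :: "real \<Rightarrow> 'a::{banach, second_countable_topology}"
  unfolding set_integrable_def by (rule integrable_mult_indicator) (auto simp: sets_M)

text \<open>Joint measurability of the integrand in the upper limit and the integration variable
  suffices. Continuity in \<open>x\<close> cannot be invoked, since \<open>M\<close> may have
  atoms.\<close>

lemma cum_measurable [measurable]:
  assumes [measurable]: "f \<in> borel_measurable borel"
  shows "cum f \<in> borel_measurable borel"
proof -
  have "(\<lambda>p. indicator {..<fst p} (snd p) *\<^sub>R f (snd p)) \<in> borel_measurable (borel \<Otimes>\<^sub>M M)"
  proof -
    have "Measurable.pred (borel \<Otimes>\<^sub>M M) (\<lambda>p. snd p < (fst p :: real))" by measurable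
    then have "(\<lambda>p. (if snd p < fst p then 1 else 0 :: real) *\<^sub>R f (snd p)) \<in> borel_measurable (borel \<Otimes>\<^sub>M M)"
      by measurable
    then show ?thesis by (simp add: indicator_def)
  qed
  then show ?thesis
    unfolding cum_def set_lebesgue_integral_def
    by (intro borel_measurable_lebesgue_integral[of "\<lambda>x t. indicator {..<x} t *\<^sub>R f t"])
       (simp add: case_prod_beta)
qed

lemma cum_add: "integrable M f \<Longrightarrow> integrable M g \<Longrightarrow> cum (\<lambda>t. f t + g t) x = cum f x + cum g x"
  unfolding cum_def by (intro set_integral_add set_integrable_M) auto

lemma cum_diff: "integrable M f \<Longrightarrow> integrable M g \<Longrightarrow> cum (\<lambda>t. f t - g t) x = cum f x - cum g x"
  unfolding cum_def by (intro set_integral_diff set_integrable_M) auto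

lemma cum_mono:
  fixes f g :: "real \<Rightarrow> real"
  assumes "integrable M f" "integrable M g" "\<And>t. t < x \<Longrightarrow> f t \<le> g t"
  shows "cum f x \<le> cum g x"
  unfolding cum_def using assms by (intro set_integral_mono set_integrable_M) auto

lemma norm_cum_le:
  fixes f :: "real \<Rightarrow> 'a::{banach, second_countable_topology}"
  assumes "integrable M f" "integrable M g" "\<And>t. t < x \<Longrightarrow> norm (f t) \<le> g t"
  shows "norm (cum f x) \<le> cum g x"
proof -
  have "norm (cum f x) \<le> (LINT t|M. norm (indicator {..<x} t *\<^sub>R f t))"
    unfolding cum_def set_lebesgue_integral_def by (rule integral_norm_bound)
  also have "\<dots> \<le> cum g x"
    unfolding cum_def set_lebesgue_integral_def
    using set_integrable_M[OF assms(1), of "{..<x}"] set_integrable_M[OF assms(2), of "{..<x}"] assms(3)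
    by (intro integral_mono integrable_norm) (auto simp: set_integrable_def split: split_indicator)
  finally show ?thesis .
qed

lemma cum_bound:
  fixes f :: "real \<Rightarrow> 'a::{banach, second_countable_topology}"
  assumes "integrable M f"
  shows "norm (cum f x) \<le> (LINT t|M. norm (f t))"
proof -
  have "norm (cum f x) \<le> (LINT t|M. norm (indicator {..<x} t *\<^sub>R f t))"
    unfolding cum_def set_lebesgue_integral_def by (rule integral_norm_bound)
  also have "\<dots> \<le> (LINT t|M. norm (f t))"
    using set_integrable_M[OF assms(1), of "{..<x}"] assms
    by (intro integral_mono integrable_norm) (auto simp: set_integrable_def split: split_indicator)
  finally show ?thesis .
qed

lemma integrable_bounded:
  fixes f :: "real \<Rightarrow> 'a::{banach, second_countable_topology}"
  shows "f \<in> borel_measurable borel \<Longrightarrow> (\<And>t. norm (f t) \<le> B) \<Longrightarrow> integrable M f"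
  by (rule integrable_const_bound[where B=B]) auto

lemma integrable_bounded_mult:
  fixes f g :: "real \<Rightarrow> 'a::{banach, real_normed_algebra, second_countable_topology}"
  assumes [measurable]: "f \<in> borel_measurable borel" and "\<And>t. norm (f t) \<le> B" and "integrable M g"
  shows "integrable M (\<lambda>t. f t * g t)"
proof (rule Bochner_Integration.integrable_bound)
  show "integrable M (\<lambda>t. B * norm (g t))" using assms by auto
  show "(\<lambda>t. f t * g t) \<in> borel_measurable M" using assms(3) by measurable
  show "AE t in M. norm (f t * g t) \<le> norm (B * norm (g t))"
  proof (rule AE_I2)
    fix t
    have "norm (f t * g t) \<le> norm (f t) * norm (g t)" by (rule norm_mult_ineq)
    also have "\<dots> \<le> B * norm (g t)" by (intro mult_right_mono assms) auto
    finally show "norm (f t * g t) \<le> norm (B * norm (g t))" by simp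
  qed
qed

text \<open>Fubini on the square below \<open>x\<close>, cut along its diagonal: the two open
  triangles give the first two terms, and the diagonal carries only the atoms of
  \<open>M\<close>.\<close>

lemma cum_prod:
  fixes f g :: "real \<Rightarrow> 'a::{banach, real_normed_field, second_countable_topology}"
  assumes f: "integrable M f" and g: "integrable M g"
    and mf [measurable]: "f \<in> borel_measurable borel" and mg [measurable]: "g \<in> borel_measurable borel"
  shows "cum f x * cum g x =
    cum (\<lambda>t. cum f t * g t) x + cum (\<lambda>t. f t * cum g t) x + cum (\<lambda>t. measure M {t} *\<^sub>R (f t * g t)) x"
proof -
  interpret P: pair_sigma_finite M M ..
  \<comment> \<open>The triangle \<open>t < s < x\<close>, with \<open>t\<close> the variable of
    \<open>g\<close> and \<open>s\<close> that of \<open>f\<close>.\<close>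
  let ?k = "\<lambda>t s. (indicator {..<x} t * indicator {..<x} s * indicator {t<..} s :: real) *\<^sub>R (f s * g t)"
  have pm: "Measurable.pred (M \<Otimes>\<^sub>M M) (\<lambda>p. fst p < (snd p :: real))" by measurable
  have kint: "integrable (M \<Otimes>\<^sub>M M) (case_prod ?k)"
  proof (rule Bochner_Integration.integrable_bound)
    show "integrable (M \<Otimes>\<^sub>M M) (\<lambda>(t,s). g t * f s)"
    proof (rule P.Fubini_integrable)
      have "(\<lambda>p. g (fst p) * f (snd p)) \<in> borel_measurable (M \<Otimes>\<^sub>M M)" by measurable
      then show "(\<lambda>(t,s). g t * f s) \<in> borel_measurable (M \<Otimes>\<^sub>M M)" by (simp add: case_prod_beta)
      show "integrable M (\<lambda>t. LINT s|M. norm (case (t, s) of (t, s) \<Rightarrow> g t * f s))"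
        using g by (simp add: norm_mult)
      show "AE t in M. integrable M (\<lambda>s. case (t, s) of (t, s) \<Rightarrow> g t * f s)"
        using f by simp
    qed
    have "(\<lambda>p. ((indicator {..<x} (fst p) * indicator {..<x} (snd p) * (if fst p < snd p then 1 else 0)) :: real) *\<^sub>R (f (snd p) * g (fst p)))
       \<in> borel_measurable (M \<Otimes>\<^sub>M M)" using pm by measurable
    then show "case_prod ?k \<in> borel_measurable (M \<Otimes>\<^sub>M M)"
      by (simp add: case_prod_beta indicator_def)
  qed (auto split: split_indicator simp: norm_mult)
  have sI: "integrable M (\<lambda>t. indicator A t *\<^sub>R f t)" if "A \<in> sets borel" for A
    using set_integrable_M[OF f that] by (simp add: set_integrable_def)
  have point: "(LINT s|M. indicator {t} s *\<^sub>R f s) = measure M {t} *\<^sub>R f t" for t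
  proof -
    have "(LINT s|M. indicator {t} s *\<^sub>R f s) = (LINT s|M. indicator {t} s *\<^sub>R f t)"
      by (intro Bochner_Integration.integral_cong) (auto split: split_indicator)
    also have "\<dots> = measure M {t} *\<^sub>R f t" by (simp add: sets_M emeasure_eq_measure)
    finally show ?thesis .
  qed
  \<comment> \<open>For fixed \<open>t\<close> the range of \<open>s\<close> is cut into
    \<open>s < t\<close>, \<open>s = t\<close> and \<open>t < s < x\<close>; integration against
    \<open>g\<close> then yields the three parts of the square.\<close>
  have split: "cum f x = cum f t + measure M {t} *\<^sub>R f t + (LINT s|M. (indicator {..<x} s * indicator {t<..} s) *\<^sub>R f s)"
    if "t < x" for t
  proof -
    have "cum f x = (LINT s|M. indicator {..<t} s *\<^sub>R f s + indicator {t} s *\<^sub>R f s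
        + (indicator ({..<x} \<inter> {t<..}) s) *\<^sub>R f s)"
      unfolding cum_def set_lebesgue_integral_def using that
      by (intro Bochner_Integration.integral_cong) (auto split: split_indicator)
    also have "\<dots> = cum f t + (LINT s|M. indicator {t} s *\<^sub>R f s) + (LINT s|M. (indicator ({..<x} \<inter> {t<..}) s) *\<^sub>R f s)"
      unfolding cum_def set_lebesgue_integral_def
      by (simp add: sI)
    also have "(LINT s|M. indicator {t} s *\<^sub>R f s) = measure M {t} *\<^sub>R f t" by (rule point)
    finally show ?thesis by (simp add: indicator_inter_arith)
  qed
  have i1: "integrable M (\<lambda>t. cum f t * g t)"
    using cum_bound[OF f] by (intro integrable_bounded_mult g) auto
  \<comment> \<open>Atom masses are the \<open>M\<close>-masses of the sections of the diagonal,
    hence measurable in \<open>t\<close>.\<close>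
  have mt [measurable]: "(\<lambda>t. measure M {t}) \<in> borel_measurable borel"
  proof -
    have "{p \<in> space (borel \<Otimes>\<^sub>M M). snd p = (fst p :: real)} \<in> sets (borel \<Otimes>\<^sub>M M)"
      by measurable
    from measurable_emeasure_Pair[OF this]
    have "(\<lambda>t. emeasure M (Pair t -` {p \<in> space (borel \<Otimes>\<^sub>M M). snd p = fst p})) \<in> borel_measurable borel" .
    moreover have "Pair t -` {p \<in> space (borel \<Otimes>\<^sub>M M). snd p = fst p} = {t}" for t
      by (auto simp: space_pair_measure)
    ultimately have "(\<lambda>t. emeasure M {t}) \<in> borel_measurable borel" by (simp only:)
    then show ?thesis unfolding measure_def by measurable
  qed
  \<comment> \<open>The product \<open>f t * g t\<close> alone need not be integrable; but the mass
    of an atom times \<open>norm (f t)\<close> is at most the L1 norm of \<open>f\<close>, so the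
    atomic weight makes the first factor bounded.\<close>
  have i3: "integrable M (\<lambda>t. measure M {t} *\<^sub>R (f t * g t))"
  proof -
    have "norm (measure M {t} *\<^sub>R f t) \<le> (LINT t|M. norm (f t))" for t
    proof -
      have "measure M {t} *\<^sub>R f t = (LINT s|M. indicator {t} s *\<^sub>R f s)" by (rule point[symmetric])
      also have "norm \<dots> \<le> (LINT s|M. norm (indicator {t} s *\<^sub>R f s))" by (rule integral_norm_bound)
      also have "\<dots> \<le> (LINT t|M. norm (f t))"
        by (intro integral_mono integrable_norm sI f) (auto split: split_indicator)
      finally show ?thesis .
    qed
    then have "integrable M (\<lambda>t. (measure M {t} *\<^sub>R f t) * g t)"
      by (intro integrable_bounded_mult g) auto
    then show ?thesis by simp
  qed
  have i4: "integrable M (\<lambda>t. LINT s|M. ?k t s)"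
    using P.integrable_fst[OF kint] by simp
  have "cum f x * cum g x = (LINT t|M. indicator {..<x} t *\<^sub>R (cum f x * g t))"
    unfolding cum_def set_lebesgue_integral_def by (simp del: mult_scaleR_right flip: mult_scaleR_right)
  also have "\<dots> = (LINT t|M. indicator {..<x} t *\<^sub>R (cum f t * g t) +
     (indicator {..<x} t *\<^sub>R (measure M {t} *\<^sub>R (f t * g t)) + (LINT s|M. ?k t s)))"
  proof (intro Bochner_Integration.integral_cong refl)
    fix t
    have "(LINT s|M. ?k t s) = indicator {..<x} t *\<^sub>R ((LINT s|M. (indicator {..<x} s * indicator {t<..} s) *\<^sub>R f s) * g t)"
    proof -
      have "(LINT s|M. ?k t s) = (LINT s|M. (indicator {..<x} t *\<^sub>R ((indicator {..<x} s * indicator {t<..} s) *\<^sub>R f s)) * g t)"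
        by (intro Bochner_Integration.integral_cong) (auto split: split_indicator)
      also have "\<dots> = (LINT s|M. (indicator {..<x} t *\<^sub>R ((indicator {..<x} s * indicator {t<..} s) *\<^sub>R f s))) * g t"
        by (rule integral_mult_left_zero)
      also have "\<dots> = indicator {..<x} t *\<^sub>R ((LINT s|M. (indicator {..<x} s * indicator {t<..} s) *\<^sub>R f s) * g t)"
        by (subst integral_scaleR_right) simp
      finally show ?thesis .
    qed
    then show "indicator {..<x} t *\<^sub>R (cum f x * g t) = indicator {..<x} t *\<^sub>R (cum f t * g t) +
     (indicator {..<x} t *\<^sub>R (measure M {t} *\<^sub>R (f t * g t)) + (LINT s|M. ?k t s))"
      using split[of t] by (auto split: split_indicator simp: algebra_simps)
  qed
  also have "\<dots> = cum (\<lambda>t. cum f t * g t) x + (cum (\<lambda>t. measure M {t} *\<^sub>R (f t * g t)) x + (LINT t|M. (LINT s|M. ?k t s)))"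
    unfolding cum_def[of _ x] set_lebesgue_integral_def[of M "{..<x}"]
    using set_integrable_M[OF i1, of "{..<x}"] set_integrable_M[OF i3, of "{..<x}"]
    by (subst Bochner_Integration.integral_add, simp_all add: set_integrable_def i4)
  \<comment> \<open>Exchanging the order turns the inner integral over \<open>t < s\<close> into
    \<open>cum g s\<close>.\<close>
  also have "(LINT t|M. (LINT s|M. ?k t s)) = (LINT s|M. (LINT t|M. ?k t s))"
    by (rule P.Fubini_integral[OF kint, symmetric])
  also have "\<dots> = cum (\<lambda>t. f t * cum g t) x"
    unfolding cum_def[of _ x] set_lebesgue_integral_def[of M "{..<x}"]
  proof (intro Bochner_Integration.integral_cong refl)
    fix s
    have "(LINT t|M. ?k t s) = (LINT t|M. (indicator {..<x} s *\<^sub>R f s) * (indicator {..<s} t *\<^sub>R g t))"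
      by (intro Bochner_Integration.integral_cong) (auto split: split_indicator)
    also have "\<dots> = (indicator {..<x} s *\<^sub>R f s) * cum g s"
      unfolding cum_def set_lebesgue_integral_def by (rule integral_mult_right_zero)
    finally show "(LINT t|M. ?k t s) = indicator {..<x} s *\<^sub>R (f s * cum g s)" by simp
  qed
  finally show ?thesis by simp
qed

end

section \<open>Picard iteration\<close>

context finite_borel
begin

lemma cum_mult_right: "cum (\<lambda>t. c * f t) x = c * cum f x"
  for c :: "'a::{banach, real_normed_field, second_countable_topology}"
  by (simp add: cum_def)

text \<open>The majorants of the Picard scheme; for Lebesgue measure on an interval starting at 0
  they would be \<open>x^n / n!\<close>.\<close>

primrec iter :: "nat \<Rightarrow> real \<Rightarrow> real" where
  "iter 0 = (\<lambda>x. 1)"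
| "iter (Suc n) = cum (iter n)"

lemma iter_measurable [measurable]: "iter n \<in> borel_measurable borel"
  by (induction n) auto

lemma iter_integrable: "integrable M (iter n)"
proof (induction n)
  case (Suc n)
  then show ?case
    using cum_bound[OF Suc] by (intro integrable_bounded) auto
qed simp

lemma iter_nonneg: "0 \<le> iter n x"
  by (induction n arbitrary: x)
     (auto simp: cum_def set_lebesgue_integral_def intro!: integral_nonneg_AE)

lemma iter_1_le: "iter (Suc 0) x \<le> measure M UNIV"
  using cum_bound[of "iter 0" x] by (simp add: iter_integrable)

text \<open>The product rule turns the iterated integrals into powers; only an inequality holds, because
  the atoms of \<open>M\<close> contribute a nonnegative diagonal term.\<close>

lemma iter_Suc_le: "real (Suc n) * iter (Suc n) x \<le> iter (Suc 0) x * iter n x"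
proof (induction n arbitrary: x)
  case (Suc n)
  have int: "integrable M (\<lambda>t. iter (Suc 0) t * iter n t)"
    using iter_1_le iter_nonneg[of "Suc 0"]
    by (intro integrable_bounded_mult iter_integrable) auto
  \<comment> \<open>The induction hypothesis, integrated once more. Of the \<open>n + 2\<close>
    copies, \<open>n + 1\<close> are thereby bounded by the first triangle of the product rule; the
    remaining copy is exactly its second triangle.\<close>
  have i1: "cum (\<lambda>t. real (Suc n) * iter (Suc n) t) x \<le> cum (\<lambda>t. cum (iter 0) t * iter n t) x"
    using int Suc.IH by (intro cum_mono integrable_mult_right iter_integrable) auto
  have "real (Suc (Suc n)) * iter (Suc (Suc n)) x
      = cum (\<lambda>t. real (Suc n) * iter (Suc n) t) x + cum (\<lambda>t. 1 * iter (Suc n) t) x"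
    by (simp only: cum_mult_right iter.simps(2) mult_1) (simp add: algebra_simps)
  also have "\<dots> \<le> cum (\<lambda>t. cum (iter 0) t * iter n t) x + cum (\<lambda>t. iter 0 t * cum (iter n) t) x
      + cum (\<lambda>t. measure M {t} *\<^sub>R (iter 0 t * iter n t)) x"
  proof -
    have "0 \<le> cum (\<lambda>t. measure M {t} *\<^sub>R (iter 0 t * iter n t)) x"
      unfolding cum_def set_lebesgue_integral_def
      by (intro integral_nonneg_AE) (auto simp: iter_nonneg)
    with i1 show ?thesis by simp
  qed
  also have "\<dots> = cum (iter 0) x * cum (iter n) x"
    by (rule cum_prod[symmetric]) (auto intro: iter_integrable iter_measurable simp del: iter.simps)
  finally show ?case by simp
qed simp

text \<open>Iterating the preceding inequality produces the factorial, so that the Picard series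
  converges whatever the mass of \<open>M\<close> and the bound on the coefficients.\<close>

lemma iter_le: "iter n x \<le> measure M UNIV ^ n / fact n"
proof (induction n)
  case (Suc n)
  have "real (Suc n) * iter (Suc n) x \<le> iter (Suc 0) x * iter n x" by (rule iter_Suc_le)
  also have "\<dots> \<le> measure M UNIV * (measure M UNIV ^ n / fact n)"
    by (intro mult_mono iter_1_le Suc iter_nonneg) auto
  finally have "iter (Suc n) x * real (Suc n) \<le> measure M UNIV ^ Suc n / fact n"
    by (simp only: mult.commute[of _ "real (Suc n)"]) simp
  then have "iter (Suc n) x \<le> (measure M UNIV ^ Suc n / fact n) / real (Suc n)"
    by (simp only: pos_le_divide_eq of_nat_0_less_iff zero_less_Suc)
  then show ?case by (simp add: field_simps)
qed simp

text \<open>Termwise integration under a summable uniform majorant; as \<open>M\<close> is finite,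
  the integrals of the norms are summable as well.\<close>

lemma cum_sums:
  fixes c :: "nat \<Rightarrow> real \<Rightarrow> complex"
  assumes mc [measurable]: "\<And>n. c n \<in> borel_measurable borel"
    and ms [measurable]: "s \<in> borel_measurable borel"
    and cD: "\<And>n t. norm (c n t) \<le> D n" and D: "summable D" and L: "\<And>t. norm (s t) \<le> L"
  shows "(\<lambda>n. cum (\<lambda>t. s t * c n t) x) sums cum (\<lambda>t. s t * (\<Sum>n. c n t)) x"
proof -
  let ?g = "\<lambda>n t. indicator {..<x} t *\<^sub>R (s t * c n t)"
  have D0: "0 \<le> D n" for n using cD[of n 0] norm_ge_zero order_trans by blast
  have L0: "0 \<le> L" using L[of 0] norm_ge_zero order_trans by blast
  have bd: "norm (?g n t) \<le> L * D n" for n t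
    using mult_mono[OF L cD L0 norm_ge_zero] D0 L0 by (auto simp: norm_mult split: split_indicator)
  have sc: "summable (\<lambda>n. c n t)" for t
    by (rule summable_comparison_test'[OF D]) (rule cD)
  have i: "integrable M (?g n)" for n
    using bd by (intro integrable_bounded) auto
  have "(\<lambda>n. integral\<^sup>L M (?g n)) sums (LINT t|M. (\<Sum>n. ?g n t))"
  proof (rule sums_integral[OF i])
    show "AE t in M. summable (\<lambda>n. norm (?g n t))"
      by (rule AE_I2, rule summable_comparison_test'[OF summable_mult[OF D, of L]])
         (use bd in auto)
    show "summable (\<lambda>n. LINT t|M. norm (?g n t))"
    proof (rule summable_comparison_test'[OF summable_mult[OF D, of "L * measure M UNIV"]])
      fix n
      have "norm (LINT t|M. norm (?g n t)) = (LINT t|M. norm (?g n t))" by simp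
      also have "\<dots> \<le> (LINT t|M. L * D n)"
        by (intro integral_mono integrable_norm i bd) auto
      also have "\<dots> = L * measure M UNIV * D n" by simp
      finally show "norm (LINT t|M. norm (?g n t)) \<le> L * measure M UNIV * D n" .
    qed
  qed
  also have "(LINT t|M. (\<Sum>n. ?g n t)) = (LINT t|M. indicator {..<x} t *\<^sub>R (s t * (\<Sum>n. c n t)))"
    by (intro Bochner_Integration.integral_cong refl)
       (auto simp: suminf_mult sc split: split_indicator)
  finally show ?thesis by (simp add: cum_def set_lebesgue_integral_def)
qed

text \<open>The integrated form of \<open>df = s k dM\<close>, \<open>dk = (q f - p) dM\<close>.
  With \<open>s dM\<close> = varsigma, \<open>q dM\<close> = chi - z rho and \<open>p dM\<close> = g
  rho it says \<open>(tau - z) f = g\<close>, where \<open>k\<close> is the density of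
  \<open>f\<close> with respect to varsigma. The bound \<open>B\<close> is carried along to supply
  integrability.\<close>

definition solution where
  "solution s q p f0 k0 f k B \<longleftrightarrow>
     f \<in> borel_measurable borel \<and> k \<in> borel_measurable borel \<and>
     (\<forall>x. cmod (f x) \<le> B) \<and> (\<forall>x. cmod (k x) \<le> B) \<and>
     (\<forall>x. f x = f0 + cum (\<lambda>t. s t * k t) x) \<and> (\<forall>x. k x = k0 + cum (\<lambda>t. q t * f t - p t) x)"

lemma solutionD:
  assumes "solution s q p f0 k0 f k B"
  shows "f \<in> borel_measurable borel" "k \<in> borel_measurable borel"
    "\<And>x. cmod (f x) \<le> B" "\<And>x. cmod (k x) \<le> B"
    "\<And>x. f x = f0 + cum (\<lambda>t. s t * k t) x" "\<And>x. k x = k0 + cum (\<lambda>t. q t * f t - p t) x"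
  using assms unfolding solution_def by blast+

proposition solution_exists:
  assumes ms [measurable]: "s \<in> borel_measurable borel" and mq [measurable]: "q \<in> borel_measurable borel"
    and mp [measurable]: "p \<in> borel_measurable borel" and p: "integrable M p"
    and sL: "\<And>t. norm (s t) \<le> L" and qL: "\<And>t. norm (q t) \<le> L"
  shows "\<exists>f k B. solution s q p f0 k0 f k B"
proof -
  \<comment> \<open>\<open>Y n\<close> is the n-th Picard correction, a pair because each component
    is integrated from the other one. The inhomogeneity \<open>p\<close> enters only the zeroth
    correction.\<close>
  define Y where "Y = rec_nat (\<lambda>x. f0, \<lambda>x. k0 - cum p x)
     (\<lambda>_ (f, k). (cum (\<lambda>t. s t * k t), cum (\<lambda>t. q t * f t)))"
  define a where "a = (\<lambda>n. fst (Y n))"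
  define b where "b = (\<lambda>n. snd (Y n))"
  have a0: "a 0 = (\<lambda>x. f0)" and b0: "b 0 = (\<lambda>x. k0 - cum p x)"
    and aS: "a (Suc n) = cum (\<lambda>t. s t * b n t)" and bS: "b (Suc n) = cum (\<lambda>t. q t * a n t)" for n
    by (simp_all add: a_def b_def Y_def case_prod_beta)
  define C where "C = norm f0 + norm k0 + (LINT t|M. norm (p t))"
  have L0: "0 \<le> L" using sL[of 0] norm_ge_zero order_trans by blast
  have C0: "0 \<le> C" by (simp add: C_def)
  have mab [measurable]: "a n \<in> borel_measurable borel" "b n \<in> borel_measurable borel" for n
    by (induction n) (auto simp: a0 b0 aS bS)
  \<comment> \<open>One integration costs a factor \<open>L\<close> and raises the index of
    \<open>iter\<close> by one.\<close>
  have step: "norm (cum (\<lambda>t. r t * c t) x) \<le> C * L ^ Suc n * iter (Suc n) x"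
    if [measurable]: "r \<in> borel_measurable borel" "c \<in> borel_measurable borel" and r: "\<And>t. norm (r t) \<le> L"
      and c: "\<And>t. norm (c t) \<le> C * L ^ n * iter n t" for r c :: "real \<Rightarrow> complex" and n x
  proof -
    have bd: "norm (r t * c t) \<le> C * L ^ Suc n * iter n t" for t
      using mult_mono[OF r c L0 norm_ge_zero] by (simp add: norm_mult mult_ac)
    have "integrable M (\<lambda>t. r t * c t)"
    proof (rule Bochner_Integration.integrable_bound)
      show "integrable M (\<lambda>t. C * L ^ Suc n * iter n t)" by (intro integrable_mult_right iter_integrable)
      show "AE t in M. norm (r t * c t) \<le> norm (C * L ^ Suc n * iter n t)"
        using bd by (intro AE_I2) (simp add: L0 C0 iter_nonneg)
    qed measurable
    then have "norm (cum (\<lambda>t. r t * c t) x) \<le> cum (\<lambda>t. C * L ^ Suc n * iter n t) x"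
      by (intro norm_cum_le bd integrable_mult_right iter_integrable)
    then show ?thesis by (simp add: cum_def)
  qed
  have "(\<forall>x. norm (a n x) \<le> C * L ^ n * iter n x) \<and> (\<forall>x. norm (b n x) \<le> C * L ^ n * iter n x)" for n
  proof (induction n)
    case 0
    have "norm (b 0 x) \<le> C" for x
      using norm_triangle_ineq4[of k0 "cum p x"] cum_bound[OF p, of x] norm_ge_zero[of f0]
      unfolding b0 C_def by linarith
    moreover have "norm (a 0 x) \<le> C" for x by (simp add: a0 C_def)
    ultimately show ?case by simp
  next
    case (Suc n)
    then show ?case unfolding aS bS by (blast intro: step mab ms mq sL qL)
  qed
  then have "norm (a n x) \<le> C * L ^ n * iter n x" "norm (b n x) \<le> C * L ^ n * iter n x" for n x
    by auto
  \<comment> \<open>The terms of the series for \<open>C * exp (L * measure M UNIV)\<close>: a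
    majorant independent of \<open>x\<close>, so the limits are bounded.\<close>
  moreover define D where "D = (\<lambda>n. C * ((L * measure M UNIV) ^ n / fact n))"
  moreover have "C * L ^ n * iter n x \<le> D n" for n x
  proof -
    have "C * L ^ n * iter n x \<le> C * L ^ n * (measure M UNIV ^ n / fact n)"
      using C0 L0 by (intro mult_left_mono iter_le) auto
    then show ?thesis by (simp add: D_def power_mult_distrib)
  qed
  ultimately have aD: "norm (a n x) \<le> D n" and bD: "norm (b n x) \<le> D n" for n x
    by (blast intro: order_trans)+
  have D: "summable D"
    unfolding D_def using summable_exp[of "L * measure M UNIV"]
    by (intro summable_mult) (simp add: field_simps)
  have suma: "summable (\<lambda>n. a n x)" and sumb: "summable (\<lambda>n. b n x)" for x
    by (rule summable_comparison_test'[OF D], rule aD) (rule summable_comparison_test'[OF D], rule bD)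
  define f where "f = (\<lambda>x. \<Sum>n. a n x)"
  define k where "k = (\<lambda>x. \<Sum>n. b n x)"
  have mf [measurable]: "f \<in> borel_measurable borel" and mk [measurable]: "k \<in> borel_measurable borel"
    unfolding f_def k_def by measurable
  have fB: "norm (f x) \<le> suminf D" and kB: "norm (k x) \<le> suminf D" for x
    by (auto simp: f_def k_def intro!: norm_suminf_le aD bD D)
  have "f x = f0 + cum (\<lambda>t. s t * k t) x" "k x = k0 + cum (\<lambda>t. q t * f t - p t) x" for x
  proof -
    have "(\<lambda>n. a (Suc n) x) sums cum (\<lambda>t. s t * k t) x"
      unfolding aS k_def by (rule cum_sums[OF mab(2) ms bD D sL])
    from sums_unique[OF this] show "f x = f0 + cum (\<lambda>t. s t * k t) x"
      using suminf_split_head[OF suma, of x] by (simp add: f_def a0)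
    have "(\<lambda>n. b (Suc n) x) sums cum (\<lambda>t. q t * f t) x"
      unfolding bS f_def by (rule cum_sums[OF mab(1) mq aD D qL])
    from sums_unique[OF this] have "k x = k0 - cum p x + cum (\<lambda>t. q t * f t) x"
      using suminf_split_head[OF sumb, of x] by (simp add: k_def b0)
    moreover have "integrable M (\<lambda>t. q t * f t)"
      using qL fB by (intro integrable_bounded_mult integrable_bounded[where B="suminf D"]) auto
    ultimately show "k x = k0 + cum (\<lambda>t. q t * f t - p t) x"
      using cum_diff[OF _ p, of "\<lambda>t. q t * f t" x] by simp
  qed
  with mf mk fB kB have "solution s q p f0 k0 f k (suminf D)" unfolding solution_def by blast
  then show ?thesis by blast
qed

end

section \<open>Lagrange identity and common densities\<close>

context finite_borel
begin

text \<open>The assumption \<open>diag\<close> removes the atomic term of \<open>cum_prod\<close>,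
  so the classical integration by parts survives although \<open>F\<close> and \<open>G\<close> may
  have jumps.\<close>

lemma cum_parts:
  fixes f g :: "real \<Rightarrow> 'a::{banach, real_normed_field, second_countable_topology}"
  assumes f: "integrable M f" and g: "integrable M g"
    and mf [measurable]: "f \<in> borel_measurable borel" and mg [measurable]: "g \<in> borel_measurable borel"
    and F: "\<And>x. F x = F0 + cum f x" and G: "\<And>x. G x = G0 + cum g x"
    and diag: "\<And>t. measure M {t} *\<^sub>R (f t * g t) = 0"
  shows "F x * G x = F0 * G0 + cum (\<lambda>t. F t * g t + f t * G t) x"
proof -
  have i1: "integrable M (\<lambda>t. cum f t * g t)"
    using cum_bound[OF f] by (intro integrable_bounded_mult g) auto
  have i2: "integrable M (\<lambda>t. cum g t * f t)"
    using cum_bound[OF g] by (intro integrable_bounded_mult f) auto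
  have 1: "cum f x * cum g x = cum (\<lambda>t. cum f t * g t) x + cum (\<lambda>t. f t * cum g t) x"
    using cum_prod[OF f g mf mg, of x] unfolding diag by (simp add: cum_def)
  have "cum (\<lambda>t. F t * g t + f t * G t) x
      = cum (\<lambda>t. (cum f t * g t + f t * cum g t) + (F0 * g t + G0 * f t)) x"
    by (simp add: F G algebra_simps)
  also have "\<dots> = cum (\<lambda>t. cum f t * g t) x + cum (\<lambda>t. f t * cum g t) x + (F0 * cum g x + G0 * cum f x)"
    using i1 i2 f g by (simp add: cum_add cum_mult_right mult.commute[of _ "cum g _"])
  finally show ?thesis by (simp add: F G 1 algebra_simps)
qed

text \<open>The product rule for \<open>f l\<close> and for \<open>w k\<close> produces the same
  terms \<open>q f w\<close> and \<open>s k l\<close>; they cancel in the difference and only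
  \<open>w p\<close> is left. The conditions \<open>sq\<close> and \<open>sp\<close>, which (H4)
  will provide, exclude atomic corrections. For \<open>p = 0\<close> this is the constancy of the
  Wronskian.\<close>

lemma lagrange_identity:
  assumes ms [measurable]: "s \<in> borel_measurable borel" and mq [measurable]: "q \<in> borel_measurable borel"
    and mp [measurable]: "p \<in> borel_measurable borel" and p: "integrable M p"
    and sL: "\<And>t. norm (s t) \<le> L" and qL: "\<And>t. norm (q t) \<le> L"
    and FK: "solution s q p f0 k0 f k B" and WL: "solution s q (\<lambda>_. 0) w0 l0 w l C"
    and sq: "\<And>t. measure M {t} = 0 \<or> s t * q t = 0" and sp: "\<And>t. measure M {t} = 0 \<or> s t * p t = 0"
  shows "f x * l x - w x * k x = f0 * l0 - w0 * k0 + cum (\<lambda>t. w t * p t) x"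
proof -
  note [measurable] = solutionD(1,2)[OF FK] solutionD(1,2)[OF WL]
  note B = solutionD(3,4)[OF FK] and C = solutionD(3,4)[OF WL]
    and f = solutionD(5)[OF FK] and k = solutionD(6)[OF FK]
    and w = solutionD(5)[OF WL] and l = solutionD(6)[OF WL, unfolded diff_0_right]
  have i: "integrable M f" "integrable M k" "integrable M w" "integrable M l"
    by (rule integrable_bounded[OF _ B(1)] integrable_bounded[OF _ B(2)]
      integrable_bounded[OF _ C(1)] integrable_bounded[OF _ C(2)]; simp)+
  have i': "integrable M (\<lambda>t. s t * k t)" "integrable M (\<lambda>t. q t * f t - p t)"
    "integrable M (\<lambda>t. s t * l t)" "integrable M (\<lambda>t. q t * w t)"
    using integrable_bounded_mult[OF _ sL i(2)] integrable_bounded_mult[OF _ qL i(1)]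
      integrable_bounded_mult[OF _ sL i(4)] integrable_bounded_mult[OF _ qL i(3)] p by auto
  have 1: "f x * l x = f0 * l0 + cum (\<lambda>t. f t * (q t * w t) + (s t * k t) * l t) x"
    by (rule cum_parts[OF i'(1,4) _ _ f l]) (use sq in \<open>auto simp: mult_ac\<close>)
  have 2: "w x * k x = w0 * k0 + cum (\<lambda>t. w t * (q t * f t - p t) + (s t * l t) * k t) x"
  proof (rule cum_parts[OF i'(3,2) _ _ w k])
    fix t
    have "s t * l t * (q t * f t - p t) = l t * f t * (s t * q t) - l t * (s t * p t)"
      by (simp add: algebra_simps)
    moreover have "measure M {t} *\<^sub>R (s t * q t) = 0" "measure M {t} *\<^sub>R (s t * p t) = 0"
      using sq[of t] sp[of t] by auto
    ultimately show "measure M {t} *\<^sub>R (s t * l t * (q t * f t - p t)) = 0"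
      using sq[of t] sp[of t] by auto
  qed auto
  have i1: "integrable M (\<lambda>t. f t * (q t * w t) + (s t * k t) * l t)"
    using integrable_bounded_mult[OF _ B(1) i'(4)] integrable_bounded_mult[OF _ C(2) i'(1)]
    by (auto simp: mult.commute[of _ "l _"])
  have i2: "integrable M (\<lambda>t. w t * (q t * f t - p t) + (s t * l t) * k t)"
    using integrable_bounded_mult[OF _ C(1) i'(2)] integrable_bounded_mult[OF _ B(2) i'(3)]
    by (auto simp: mult.commute[of _ "k _"])
  have "f x * l x - w x * k x = f0 * l0 - w0 * k0 + cum (\<lambda>t. f t * (q t * w t) + (s t * k t) * l t -
      (w t * (q t * f t - p t) + (s t * l t) * k t)) x"
    unfolding 1 2 cum_diff[OF i1 i2] by simp
  also have "(\<lambda>t. f t * (q t * w t) + (s t * k t) * l t - (w t * (q t * f t - p t) + (s t * l t) * k t))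
      = (\<lambda>t. w t * p t)"
    by (auto simp: algebra_simps)
  finally show ?thesis .
qed

end

text \<open>The sum of the measures dominates each of them, and the Radon-Nikodym derivatives add up
  to 1 almost everywhere, so each is at most 1. Bounded coefficients are what the Picard iteration
  requires.\<close>

lemma common_density:
  fixes \<nu> :: "'i \<Rightarrow> real measure"
  assumes I: "finite I" and fin: "\<And>i. i \<in> I \<Longrightarrow> finite_borel (\<nu> i)"
  obtains M d where "finite_borel M"
    "\<And>i. i \<in> I \<Longrightarrow> d i \<in> borel_measurable borel"
    "\<And>i x. i \<in> I \<Longrightarrow> 0 \<le> d i x" "\<And>i x. i \<in> I \<Longrightarrow> d i x \<le> (1::real)"
    "\<And>i. i \<in> I \<Longrightarrow> \<nu> i = density M (\<lambda>x. ennreal (d i x))"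
proof -
  define m where "m = (\<lambda>A. \<Sum>i\<in>I. emeasure (\<nu> i) A)"
  define M where "M = measure_of UNIV (sets borel) m"
  have sets: "sets (\<nu> i) = sets borel" if "i \<in> I" for i
    using fin[OF that] by (simp add: finite_borel_def finite_borel_axioms_def)
  have spM: "space M = UNIV" and seM: "sets M = sets borel"
    by (simp_all add: M_def sets.sigma_sets_eq[of borel, simplified])
  have eM: "emeasure M A = m A" if "A \<in> sets borel" for A
    unfolding M_def
  proof (rule emeasure_measure_of_sigma)
    show "sigma_algebra UNIV (sets borel)" using sets.sigma_algebra_axioms[of borel] by simp
    show "positive (sets borel) m" by (simp add: positive_def m_def)
    show "countably_additive (sets borel) m"
    proof (rule countably_additiveI)
      fix A :: "nat \<Rightarrow> real set" assume A: "range A \<subseteq> sets borel" "disjoint_family A"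
      have "(\<Sum>n. m (A n)) = (\<Sum>i\<in>I. \<Sum>n. emeasure (\<nu> i) (A n))"
        unfolding m_def by (rule suminf_sum) simp
      also have "\<dots> = m (\<Union> (range A))"
        unfolding m_def using A sets by (intro sum.cong refl suminf_emeasure) auto
      finally show "(\<Sum>n. m (A n)) = m (\<Union> (range A))" .
    qed
  qed (use that in auto)
  have finM: "finite_borel M"
  proof -
    have "emeasure (\<nu> i) UNIV \<noteq> \<infinity>" if "i \<in> I" for i
      using fin[OF that] by (simp add: finite_borel_def finite_measure.emeasure_finite)
    then have "emeasure M UNIV \<noteq> \<infinity>"
      using I by (simp add: eM m_def)
    then show ?thesis
      unfolding finite_borel_def finite_borel_axioms_def
      by (intro conjI finite_measureI) (simp_all add: spM seM)
  qed
  interpret finite_borel M by (rule finM)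
  define r where "r = (\<lambda>i. RN_deriv M (\<nu> i))"
  have mr [measurable]: "r i \<in> borel_measurable borel" for i
    using borel_measurable_RN_deriv[of M "\<nu> i"] by (simp add: r_def cong: measurable_cong_sets[OF sets_M refl])
  have dr: "density M (r i) = \<nu> i" if i: "i \<in> I" for i
    unfolding r_def
  proof (rule density_RN_deriv)
    show "absolutely_continuous M (\<nu> i)"
      unfolding absolutely_continuous_def null_sets_def using I i
      by (auto simp: seM eM m_def sets)
  qed (use i sets seM in auto)
  \<comment> \<open>Both sides are the sum measure \<open>M\<close> itself, so uniqueness of
    densities yields the value 1.\<close>
  have "density M (\<lambda>x. \<Sum>i\<in>I. r i x) = density M (\<lambda>x. 1)"
  proof (rule measure_eqI)
    fix A assume "A \<in> sets (density M (\<lambda>x. \<Sum>i\<in>I. r i x))"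
    then have A [measurable]: "A \<in> sets borel" by (simp add: seM)
    have "emeasure (density M (\<lambda>x. \<Sum>i\<in>I. r i x)) A = (\<Sum>i\<in>I. \<integral>\<^sup>+x. r i x * indicator A x \<partial>M)"
      by (subst emeasure_density) (auto simp: sum_distrib_right nn_integral_sum)
    also have "\<dots> = (\<Sum>i\<in>I. emeasure (density M (r i)) A)"
      by (intro sum.cong refl) (simp add: emeasure_density)
    also have "\<dots> = emeasure (density M (\<lambda>x. 1)) A"
      using I by (simp add: dr eM m_def density_1)
    finally show "emeasure (density M (\<lambda>x. \<Sum>i\<in>I. r i x)) A = emeasure (density M (\<lambda>x. 1)) A" .
  qed simp
  then have ae: "AE x in M. (\<Sum>i\<in>I. r i x) = 1"
    by (intro density_unique) auto
  have ae1: "AE x in M. r i x \<le> 1" if i: "i \<in> I" for i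
    using ae
  proof eventually_elim
    case (elim x)
    have "r i x \<le> (\<Sum>i\<in>I. r i x)" by (rule member_le_sum) (use i I in auto)
    then show ?case by (simp add: elim)
  qed
  \<comment> \<open>Truncation changes the derivatives only on a null set and turns almost
    everywhere bounds into pointwise ones.\<close>
  define d where "d = (\<lambda>i x. min 1 (enn2real (r i x)))"
  show thesis
  proof (rule that[OF finM, of d])
    fix i assume i: "i \<in> I"
    show "d i \<in> borel_measurable borel" unfolding d_def by measurable
    show "0 \<le> d i x" "d i x \<le> 1" for x by (auto simp: d_def)
    have "AE x in M. r i x = ennreal (d i x)"
      using ae1[OF i]
    proof eventually_elim
      case (elim x)
      have "r i x < top" using elim ennreal_one_less_top by (rule le_less_trans)
      then have "ennreal (enn2real (r i x)) = r i x" by simp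
      moreover have "enn2real (r i x) \<le> 1" using elim by (intro enn2real_leI) auto
      ultimately show ?case by (simp add: d_def min_def)
    qed
    then have "density M (r i) = density M (\<lambda>x. ennreal (d i x))"
      by (intro density_cong) (auto simp: d_def)
    then show "\<nu> i = density M (\<lambda>x. ennreal (d i x))" by (simp add: dr i)
  qed
qed

section \<open>Square-integrable functions\<close>

lemma borel_measurable_cnj [measurable]:
  "f \<in> borel_measurable M \<Longrightarrow> (\<lambda>x. cnj (f x)) \<in> borel_measurable M"
  by (rule measurable_compose[OF _ borel_measurable_continuous_onI]) (auto intro: continuous_intros)

lemma L2_bound:
  assumes "L2 M f" "g \<in> borel_measurable M" "\<And>x. x \<in> space M \<Longrightarrow> (cmod (g x))\<^sup>2 \<le> C * (cmod (f x))\<^sup>2"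
  shows "L2 M g"
  unfolding L2_def
proof
  show "integrable M (\<lambda>x. (cmod (g x))\<^sup>2)"
  proof (rule Bochner_Integration.integrable_bound)
    show "integrable M (\<lambda>x. C * (cmod (f x))\<^sup>2)" using assms by (auto simp: L2_def)
    show "(\<lambda>x. (cmod (g x))\<^sup>2) \<in> borel_measurable M" using assms(2) by measurable
    show "AE x in M. norm ((cmod (g x))\<^sup>2) \<le> norm (C * (cmod (f x))\<^sup>2)"
    proof (rule AE_I2)
      fix x assume "x \<in> space M"
      from assms(3)[OF this] show "norm ((cmod (g x))\<^sup>2) \<le> norm (C * (cmod (f x))\<^sup>2)"
        using abs_ge_self[of "C * (cmod (f x))\<^sup>2"] by (simp only: real_norm_def abs_power2)
    qed
  qed
qed (rule assms(2))

lemma L2_add: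
  assumes "L2 M f" "L2 M g"
  shows "L2 M (\<lambda>x. f x + g x)"
  unfolding L2_def
proof
  have m [measurable]: "f \<in> borel_measurable M" "g \<in> borel_measurable M" using assms by (auto simp: L2_def)
  show "(\<lambda>x. f x + g x) \<in> borel_measurable M" by measurable
  show "integrable M (\<lambda>x. (cmod (f x + g x))\<^sup>2)"
  proof (rule Bochner_Integration.integrable_bound)
    show "integrable M (\<lambda>x. 2 * (cmod (f x))\<^sup>2 + 2 * (cmod (g x))\<^sup>2)" using assms by (auto simp: L2_def)
    have "(cmod (a + b))\<^sup>2 \<le> 2 * (cmod a)\<^sup>2 + 2 * (cmod b)\<^sup>2" for a b :: complex
    proof -
      have "(cmod (a + b))\<^sup>2 \<le> (cmod a + cmod b)\<^sup>2" by (intro power_mono norm_triangle_ineq) simp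
      also have "\<dots> \<le> 2 * (cmod a)\<^sup>2 + 2 * (cmod b)\<^sup>2"
        using sum_squares_bound[of "cmod a" "cmod b"] by (simp add: power2_sum)
      finally show ?thesis .
    qed
    then show "AE x in M. norm ((cmod (f x + g x))\<^sup>2) \<le> norm (2 * (cmod (f x))\<^sup>2 + 2 * (cmod (g x))\<^sup>2)"
      by simp
  qed measurable
qed

lemma L2_cmult: "L2 M f \<Longrightarrow> L2 M (\<lambda>x. c * f x)"
  by (rule L2_bound[where C="(cmod c)\<^sup>2"]) (auto simp: L2_def norm_mult power_mult_distrib)

lemma L2_diff: "L2 M f \<Longrightarrow> L2 M g \<Longrightarrow> L2 M (\<lambda>x. f x - g x)"
  using L2_add[of M f "\<lambda>x. - 1 * g x"] L2_cmult[of M g "- 1"] by simp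

lemma L2_cnj: "L2 M f \<Longrightarrow> L2 M (\<lambda>x. cnj (f x))"
  by (rule L2_bound[where C=1]) (auto simp: L2_def)

lemma L2_indicator: "L2 M f \<Longrightarrow> A \<in> sets M \<Longrightarrow> L2 M (\<lambda>x. indicator A x * f x)"
  by (rule L2_bound[where C=1]) (auto simp: L2_def split: split_indicator)

lemma L2_integrable:
  assumes "L2 M f" "L2 M g"
  shows "integrable M (\<lambda>x. f x * cnj (g x))"
proof (rule Bochner_Integration.integrable_bound)
  have m [measurable]: "f \<in> borel_measurable M" "g \<in> borel_measurable M" using assms by (auto simp: L2_def)
  show "integrable M (\<lambda>x. (cmod (f x))\<^sup>2 + (cmod (g x))\<^sup>2)" using assms by (auto simp: L2_def)
  show "(\<lambda>x. f x * cnj (g x)) \<in> borel_measurable M" by measurable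
  have "a * b \<le> a\<^sup>2 + b\<^sup>2" if "0 \<le> a" "0 \<le> b" for a b :: real
    using sum_squares_bound[of a b] that mult_nonneg_nonneg[OF that] by linarith
  then show "AE x in M. norm (f x * cnj (g x)) \<le> norm ((cmod (f x))\<^sup>2 + (cmod (g x))\<^sup>2)"
    by (simp add: norm_mult)
qed

lemma l2inner_diff_left:
  "L2 M f \<Longrightarrow> L2 M g \<Longrightarrow> L2 M h \<Longrightarrow> l2inner M (\<lambda>x. f x - g x) h = l2inner M f h - l2inner M g h"
  unfolding l2inner_def left_diff_distrib
  by (intro Bochner_Integration.integral_diff L2_integrable)

lemma l2inner_diff_right:
  "L2 M f \<Longrightarrow> L2 M g \<Longrightarrow> L2 M h \<Longrightarrow> l2inner M h (\<lambda>x. f x - g x) = l2inner M h f - l2inner M h g"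
  unfolding l2inner_def complex_cnj_diff right_diff_distrib
  by (intro Bochner_Integration.integral_diff L2_integrable)

lemma l2inner_cmult_left: "l2inner M (\<lambda>x. c * f x) h = c * l2inner M f h"
  by (simp add: l2inner_def mult.assoc)

lemma l2inner_cmult_right: "l2inner M h (\<lambda>x. c * f x) = cnj c * l2inner M h f"
  by (simp add: l2inner_def mult_ac flip: integral_mult_right_zero)

lemma l2inner_self: "l2inner M f f = of_real (LINT x|M. (cmod (f x))\<^sup>2)"
  by (simp add: l2inner_def complex_norm_square[symmetric] del: of_real_power
      flip: integral_complex_of_real)

lemma l2inner_self_0:
  assumes "L2 M f" "l2inner M f f = 0"
  shows "AE x in M. f x = 0"
proof -
  have "(LINT x|M. (cmod (f x))\<^sup>2) = 0" using assms(2) by (simp only: l2inner_self of_real_eq_0_iff)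
  then show ?thesis
    using assms(1) by (subst (asm) integral_nonneg_eq_0_iff_AE) (auto simp: L2_def)
qed

lemma l2_project1:
  assumes "L2 M u" "L2 M w"
  obtains c where "l2inner M (\<lambda>x. u x - c * w x) w = 0"
proof (cases "l2inner M w w = 0")
  case True
  \<comment> \<open>For a null function \<open>w\<close> the quotient formula breaks down, but then
    every \<open>u\<close> is orthogonal to \<open>w\<close> and \<open>c = 0\<close>
    serves.\<close>
  have "AE x in M. u x * cnj (w x) = 0"
    using l2inner_self_0[OF assms(2) True] by eventually_elim simp
  then have "l2inner M u w = 0" unfolding l2inner_def by (rule integral_eq_zero_AE)
  then show thesis by (intro that[of 0]) simp
next
  case False
  let ?c = "l2inner M u w / l2inner M w w"
  have "l2inner M (\<lambda>x. u x - ?c * w x) w = l2inner M u w - ?c * l2inner M w w"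
    by (simp only: l2inner_diff_left[OF assms(1) L2_cmult[OF assms(2)] assms(2)] l2inner_cmult_left)
  with False show thesis by (intro that[of ?c]) simp
qed

lemma l2inner_cnj: "l2inner M g f = cnj (l2inner M f g)"
  unfolding l2inner_def Bochner_Integration.integral_cnj[symmetric] by (simp add: mult.commute)

text \<open>Gram-Schmidt: \<open>w\<close> is first made orthogonal to \<open>v\<close>, then
  \<open>u\<close> is projected onto the two directions one after the other. Since each projection
  tolerates a null direction, \<open>v\<close> and \<open>w\<close> may be dependent.\<close>

lemma l2_project2:
  assumes u: "L2 M u" and v: "L2 M v" and w: "L2 M w"
  obtains c d where "l2inner M (\<lambda>x. u x - (c * v x + d * w x)) v = 0"
    "l2inner M (\<lambda>x. u x - (c * v x + d * w x)) w = 0"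
proof -
  obtain e where e: "l2inner M (\<lambda>x. w x - e * v x) v = 0" using l2_project1[OF w v] .
  let ?w = "\<lambda>x. w x - e * v x"
  have w': "L2 M ?w" by (intro L2_diff L2_cmult v w)
  obtain c where c: "l2inner M (\<lambda>x. u x - c * v x) v = 0" using l2_project1[OF u v] .
  obtain d where d: "l2inner M (\<lambda>x. u x - d * ?w x) ?w = 0" using l2_project1[OF u w'] .
  let ?r = "\<lambda>x. u x - c * v x - d * ?w x"
  have r: "L2 M ?r" by (intro L2_diff L2_cmult u v w)
  have rv: "l2inner M ?r v = 0"
    using c e by (simp add: l2inner_diff_left L2_diff L2_cmult u v w l2inner_cmult_left)
  have "l2inner M v ?w = 0" using e l2inner_cnj[of M v ?w] by simp
  then have "l2inner M ?r ?w = 0"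
    using d by (simp add: l2inner_diff_left[of M] L2_diff L2_cmult u v w w' l2inner_cmult_left)
  \<comment> \<open>\<open>w\<close> is the orthogonalised vector plus \<open>e * v\<close>, and the
    residual is orthogonal to both.\<close>
  then have rw: "l2inner M ?r w = 0"
    using rv by (simp add: l2inner_diff_right[OF w L2_cmult[OF v] r] l2inner_cmult_right)
  have eq: "?r = (\<lambda>x. u x - ((c - d * e) * v x + d * w x))" by (auto simp: algebra_simps)
  show thesis by (rule that[of "c - d * e" d]) (use rv rw in \<open>simp_all only: eq\<close>)
qed

section \<open>Integrals and atoms of the coefficient measures in terms of the common
  measure\<close>

context finite_borel
begin

context
  fixes X :: "real measure" and J :: "real set" and d :: "real \<Rightarrow> real"
  assumes X: "sets X = sets borel" and J: "J \<in> sets borel"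
    and d [measurable]: "d \<in> borel_measurable borel" and d0: "\<And>t. 0 \<le> d t"
    and eq: "density X (\<lambda>t. ennreal (indicator J t)) = density M (\<lambda>t. ennreal (d t))"
begin

lemma density_integral:
  fixes h :: "real \<Rightarrow> complex"
  assumes h: "h \<in> borel_measurable borel" "\<And>t. t \<notin> J \<Longrightarrow> h t = 0"
  shows "(LINT t|M. complex_of_real (d t) * h t) = (LINT t|X. h t)"
    and "integrable M (\<lambda>t. complex_of_real (d t) * h t) \<longleftrightarrow> integrable X h"
proof -
  have [measurable]: "h \<in> borel_measurable X" "J \<in> sets X" using h(1) X J by (auto cong: measurable_cong_sets)
  have [measurable]: "h \<in> borel_measurable M" using h(1) by measurable
  have e: "(\<lambda>t. indicator J t *\<^sub>R h t) = h" using h(2) by (auto split: split_indicator)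
  have "(LINT t|X. h t) = (LINT t|density X (\<lambda>t. ennreal (indicator J t)). h t)"
    by (subst integral_density) (auto simp: e)
  also have "\<dots> = (LINT t|M. complex_of_real (d t) * h t)"
    unfolding eq using d0 by (subst integral_density) (auto simp: scaleR_conv_of_real)
  finally show "(LINT t|M. complex_of_real (d t) * h t) = (LINT t|X. h t)" ..
  have "integrable X h \<longleftrightarrow> integrable (density X (\<lambda>t. ennreal (indicator J t))) h"
    by (subst integrable_density) (auto simp: e)
  also have "\<dots> \<longleftrightarrow> integrable M (\<lambda>t. complex_of_real (d t) * h t)"
    unfolding eq using d0 by (subst integrable_density) (auto simp: scaleR_conv_of_real)
  finally show "integrable M (\<lambda>t. complex_of_real (d t) * h t) \<longleftrightarrow> integrable X h" ..
qed

lemma cum_density: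
  fixes h :: "real \<Rightarrow> complex"
  assumes [measurable]: "h \<in> borel_measurable borel" and "\<And>t. t \<notin> J \<Longrightarrow> h t = 0"
  shows "cum (\<lambda>t. complex_of_real (d t) * h t) x = set_lebesgue_integral X {..<x} h"
  unfolding cum_def set_lebesgue_integral_def
  using density_integral(1)[of "\<lambda>t. indicator {..<x} t *\<^sub>R h t"] assms by simp

text \<open>This carries (H4), a condition on point masses of the coefficient measures, over to
  their densities at the atoms of \<open>M\<close>.\<close>

lemma measure_density_point:
  assumes "t \<in> J"
  shows "measure X {t} = d t * measure M {t}"
proof -
  have "emeasure X {t} = emeasure (density X (\<lambda>t. ennreal (indicator J t))) {t}"
    using assms X J by (subst emeasure_density) (auto simp: nn_integral_indicator_singleton)
  also have "\<dots> = ennreal (d t) * emeasure M {t}"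
    unfolding eq by (subst emeasure_density) (auto simp: sets_M nn_integral_indicator_singleton)
  finally show ?thesis using d0[of t] by (simp add: measure_def enn2real_mult)
qed

end

end

section \<open>Locally finite measures\<close>

text \<open>The functions to be constructed vanish to the left of the base point, so the case
  distinction in \<open>oint\<close> disappears and oriented integrals take the form of
  \<open>cum\<close>.\<close>

lemma oint_vanishing_left:
  fixes h :: "real \<Rightarrow> complex"
  assumes "\<And>t. t < c \<Longrightarrow> h t = 0"
  shows "oint X c x h = set_lebesgue_integral X {..<x} h"
proof (cases "c < x")
  case True
  then have "(\<lambda>t. indicator {c..<x} t *\<^sub>R h t) = (\<lambda>t. indicator {..<x} t *\<^sub>R h t)"
    using assms by (auto split: split_indicator simp: fun_eq_iff not_le)
  with True show ?thesis by (simp add: oint_def set_lebesgue_integral_def)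
next
  case False
  then have "(\<lambda>t. indicator {..<x} t *\<^sub>R h t) = (\<lambda>t. 0)" "(\<lambda>t. indicator {x..<c} t *\<^sub>R h t) = (\<lambda>t. 0)"
    using assms by (auto split: split_indicator simp: fun_eq_iff)
  with False show ?thesis by (simp add: oint_def set_lebesgue_integral_def)
qed

lemma Iab_interval: "\<alpha> \<in> Iab a b \<Longrightarrow> \<beta> \<in> Iab a b \<Longrightarrow> {\<alpha>..\<beta>} \<subseteq> Iab a b"
  unfolding Iab_def by (auto intro: less_le_trans le_less_trans simp flip: ereal_less_eq(3))

lemma loc_finite_integrable:
  fixes h :: "real \<Rightarrow> complex"
  assumes X: "loc_finite a b X" and "\<alpha> \<in> Iab a b" "\<beta> \<in> Iab a b"
    and h: "h \<in> borel_measurable borel" "\<And>t. norm (h t) \<le> B"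
  shows "set_integrable X {\<alpha>..\<beta>} h"
proof -
  have s: "sets X = sets borel" and f: "emeasure X {\<alpha>..\<beta>} < \<infinity>" using assms by (auto simp: loc_finite_def)
  have [measurable]: "h \<in> borel_measurable X" using h(1) s by (simp cong: measurable_cong_sets)
  show ?thesis
    unfolding set_integrable_def
  proof (rule Bochner_Integration.integrable_bound)
    show "integrable X (\<lambda>t. indicator {\<alpha>..\<beta>} t * B)"
      using s f by (intro integrable_mult_left) (auto simp: integrable_indicator_iff)
    show "(\<lambda>t. indicator {\<alpha>..\<beta>} t *\<^sub>R h t) \<in> borel_measurable X"
      using s by measurable
    show "AE t in X. norm (indicator {\<alpha>..\<beta>} t *\<^sub>R h t) \<le> norm (indicator {\<alpha>..\<beta>} t * B)"
      using h(2) by (intro AE_I2) (auto split: split_indicator intro: order_trans[OF _ abs_ge_self])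
  qed
qed

lemma L2_bounded:
  assumes X: "loc_finite a b X" and ab: "\<alpha> \<in> Iab a b" "\<beta> \<in> Iab a b"
    and h: "h \<in> borel_measurable borel" "\<And>t. norm (h t) \<le> B" "\<And>t. t \<notin> {\<alpha>..\<beta>} \<Longrightarrow> h t = 0"
  shows "L2 X h"
proof -
  have s: "sets X = sets borel" using X by (auto simp: loc_finite_def)
  have [measurable]: "h \<in> borel_measurable borel" by (rule h)
  have "set_integrable X {\<alpha>..\<beta>} (\<lambda>t. complex_of_real ((cmod (h t))\<^sup>2))"
    using h(2) by (intro loc_finite_integrable[OF X ab, where B="B\<^sup>2"]) (auto simp: norm_power power_mono)
  moreover have "(\<lambda>t. indicator {\<alpha>..\<beta>} t *\<^sub>R complex_of_real ((cmod (h t))\<^sup>2)) = (\<lambda>t. complex_of_real ((cmod (h t))\<^sup>2))"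
    using h(3) by (auto split: split_indicator)
  ultimately show ?thesis
    unfolding L2_def set_integrable_def using h(1) s
    by (simp cong: measurable_cong_sets flip: of_real_power add: complex_of_real_integrable_eq)
qed

text \<open>The right end point is left out in accordance with integration over
  \<open>[c,x)\<close>: values at \<beta> do not see an atom at \<beta>.\<close>

lemma finite_borel_restrict:
  assumes X: "loc_finite a b X" and ab: "\<alpha> \<in> Iab a b" "\<beta> \<in> Iab a b"
  shows "finite_borel (density X (\<lambda>t. ennreal (indicator {\<alpha>..<\<beta>} t)))"
proof -
  have s: "sets X = sets borel" and f: "emeasure X {\<alpha>..\<beta>} < \<infinity>" using assms by (auto simp: loc_finite_def)
  have sp: "space X = UNIV" using sets_eq_imp_space_eq[OF s] by simp
  have "emeasure X {\<alpha>..<\<beta>} \<le> emeasure X {\<alpha>..\<beta>}" by (rule emeasure_mono) (auto simp: s)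
  with f have "emeasure X {\<alpha>..<\<beta>} < \<infinity>" by (rule order.strict_trans1[rotated])
  then have "emeasure (density X (\<lambda>t. ennreal (indicator {\<alpha>..<\<beta>} t))) UNIV < \<infinity>"
    using s by (subst emeasure_density) (auto simp: sp ennreal_indicator)
  then show ?thesis
    unfolding finite_borel_def finite_borel_axioms_def
    by (auto intro!: finite_measureI simp: s sp)
qed

section \<open>Compactly supported test functions\<close>

lemma (in finite_borel) cum_cong: "(\<And>t. t < x \<Longrightarrow> f t = g t) \<Longrightarrow> cum f x = cum g x"
  unfolding cum_def set_lebesgue_integral_def
  by (intro Bochner_Integration.integral_cong) (auto split: split_indicator)

text \<open>No mass is integrated outside the interval; hence a solution with zero values at both
  ends stays zero outside, which is how compact support arises.\<close>

lemma (in finite_borel) cum_outside: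
  assumes "\<And>t. t \<notin> {\<alpha>..<\<beta>} \<Longrightarrow> f t = 0"
  shows "x \<le> \<alpha> \<Longrightarrow> cum f x = 0" and "\<beta> \<le> x \<Longrightarrow> cum f x = cum f \<beta>"
proof -
  assume "x \<le> \<alpha>"
  then have "cum f x = cum (\<lambda>_. 0) x" using assms by (intro cum_cong) auto
  then show "cum f x = 0" by (simp add: cum_def)
next
  assume "\<beta> \<le> x"
  then have "indicator {..<x} t *\<^sub>R f t = indicator {..<\<beta>} t *\<^sub>R f t" for t
    using assms[of t] by (auto split: split_indicator)
  then show "cum f x = cum f \<beta>" unfolding cum_def set_lebesgue_integral_def by (simp only:)
qed

text \<open>The system is always solvable with zero data at \<alpha>. By the Lagrange identity the
  two integral conditions on \<open>g\<close> force zero data at \<beta> too, so \<open>f\<close>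
  has compact support and \<open>g\<close> lies in the range of \<open>T0 - z\<close>. The pairing
  with \<open>w1\<close>, \<open>w2\<close> is bilinear, without conjugation.\<close>

proposition compact_test_functions:
  fixes R SP SN XP XN :: "real measure" and z :: complex
  assumes loc: "loc_finite a b R" "loc_finite a b SP" "loc_finite a b SN"
      "loc_finite a b XP" "loc_finite a b XN"
    and atoms: "\<And>x. x \<in> Iab a b \<Longrightarrow>
        (measure SP {x} - measure SN {x}) * (measure XP {x} - measure XN {x}) = 0 \<and>
        (measure SP {x} - measure SN {x}) * measure R {x} = 0"
    and ab: "\<alpha> \<in> Iab a b" "\<beta> \<in> Iab a b"
  obtains w1 w2 C where
    "w1 \<in> borel_measurable borel" "w2 \<in> borel_measurable borel"
    "\<And>t. cmod (w1 t) \<le> C" "\<And>t. cmod (w2 t) \<le> C"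
    "\<And>g. \<lbrakk>g \<in> borel_measurable borel; L2 R g; \<And>t. t \<notin> {\<alpha>..<\<beta>} \<Longrightarrow> g t = 0;
       (LINT t|R. g t * w1 t) = 0; (LINT t|R. g t * w2 t) = 0\<rbrakk>
       \<Longrightarrow> \<exists>f. (f, \<lambda>t. g t + z * f t) \<in> T0 a b R SP SN XP XN"
proof -
  let ?J = "{\<alpha>..<\<beta>}"
  let ?I = "{R, SP, SN, XP, XN}"
  have loc': "loc_finite a b X" if "X \<in> ?I" for X using that loc by auto
  have sets: "sets X = sets borel" if "X \<in> ?I" for X using loc'[OF that] by (auto simp: loc_finite_def)
  obtain M d where M: "finite_borel M"
    and d_meas: "\<And>X. X \<in> ?I \<Longrightarrow> d X \<in> borel_measurable borel"
    and d0: "\<And>X x. X \<in> ?I \<Longrightarrow> 0 \<le> d X x" and d1: "\<And>X x. X \<in> ?I \<Longrightarrow> d X x \<le> (1::real)"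
    and dens: "\<And>X. X \<in> ?I \<Longrightarrow> density X (\<lambda>t. ennreal (indicator ?J t)) = density M (\<lambda>x. ennreal (d X x))"
    by (rule common_density[of ?I "\<lambda>X. density X (\<lambda>t. ennreal (indicator ?J t))"])
       (auto intro: finite_borel_restrict[OF _ ab] loc')
  interpret finite_borel M by (rule M)
  have [measurable]: "d R \<in> borel_measurable borel" "d SP \<in> borel_measurable borel"
    "d SN \<in> borel_measurable borel" "d XP \<in> borel_measurable borel" "d XN \<in> borel_measurable borel"
    by (auto intro: d_meas)
  have J: "?J \<in> sets borel" by simp
  note di = density_integral[OF sets J d_meas d0 dens]
  note cd = cum_density[OF sets J d_meas d0 dens]
  note pt = measure_density_point[OF sets J d_meas d0 dens]
  \<comment> \<open>The densities of varsigma and, next, of chi - z rho; the cut-off keeps solutions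
    constant outside the interval.\<close>
  define s :: "real \<Rightarrow> complex" where "s = (\<lambda>t. indicator ?J t * of_real (d SP t - d SN t))"
  define q :: "real \<Rightarrow> complex" where
    "q = (\<lambda>t. indicator ?J t * (of_real (d XP t - d XN t) - z * of_real (d R t)))"
  define L where "L = 1 + cmod z"
  have ms [measurable]: "s \<in> borel_measurable borel" and mq [measurable]: "q \<in> borel_measurable borel"
    by (simp_all add: s_def q_def)
  have ab1: "\<bar>d X t - d Y t\<bar> \<le> 1" if "X \<in> ?I" "Y \<in> ?I" for X Y t
    using d0[OF that(1), of t] d0[OF that(2), of t] d1[OF that(1), of t] d1[OF that(2), of t] by linarith
  have sL: "cmod (s t) \<le> L" for t
  proof -
    have "cmod (s t) \<le> \<bar>d SP t - d SN t\<bar>"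
      unfolding s_def by (simp only: norm_mult norm_of_real) (auto split: split_indicator)
    also have "\<dots> \<le> 1" by (rule ab1) auto
    finally show ?thesis by (simp add: L_def add_increasing2)
  qed
  have qL: "cmod (q t) \<le> L" for t
  proof -
    have "cmod (q t) \<le> cmod (of_real (d XP t - d XN t) - z * of_real (d R t))"
      unfolding q_def by (simp only: norm_mult) (auto split: split_indicator)
    also have "\<dots> \<le> \<bar>d XP t - d XN t\<bar> + cmod z * \<bar>d R t\<bar>"
      using norm_triangle_ineq4[of "of_real (d XP t - d XN t)" "z * of_real (d R t)"]
      by (simp only: norm_mult norm_of_real)
    also have "\<dots> \<le> 1 + cmod z * 1"
      using d0[of R t] d1[of R t] by (intro add_mono ab1 mult_left_mono) auto
    finally show ?thesis by (simp add: L_def)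
  qed
  \<comment> \<open>At an atom of \<open>M\<close> the point masses in (H4) are densities times the
    mass of the atom, so (H4) becomes a pointwise condition on the densities.\<close>
  have at: "measure M {t} = 0 \<or> s t * q t = 0 \<and> s t * of_real (d R t) = 0" for t
  proof (cases "t \<in> ?J")
    case True
    then have "t \<in> Iab a b" using Iab_interval[OF ab] by auto
    from atoms[OF this] have
      "measure M {t} = 0 \<or> (d SP t - d SN t) * (d XP t - d XN t) = 0 \<and> (d SP t - d SN t) * d R t = 0"
      using True by (auto simp: pt left_diff_distrib[symmetric])
    then have "measure M {t} = 0 \<or> (of_real (d SP t - d SN t) * of_real (d XP t - d XN t) = (0::complex)) \<and>
      of_real (d SP t - d SN t) * of_real (d R t) = (0::complex)"
      by (simp only: of_real_mult[symmetric] of_real_eq_0_iff)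
    then show ?thesis using True by (auto simp: s_def q_def)
  qed (auto simp: s_def)
  have i0: "integrable M (\<lambda>t. 0 :: complex)" by simp
  obtain w1 l1 C1 where W1: "solution s q (\<lambda>_. 0) 1 0 w1 l1 C1"
    using solution_exists[OF ms mq borel_measurable_const i0 sL qL] by blast
  obtain w2 l2 C2 where W2: "solution s q (\<lambda>_. 0) 0 1 w2 l2 C2"
    using solution_exists[OF ms mq borel_measurable_const i0 sL qL] by blast
  \<comment> \<open>The fundamental system has initial data (1,0) and (0,1), so its constant
    Wronskian equals 1.\<close>
  have wronskian: "w1 x * l2 x - w2 x * l1 x = 1" for x
    using lagrange_identity[OF ms mq borel_measurable_const i0 sL qL W1 W2, of x] at by (auto simp: cum_def)
  show thesis
  proof (rule that[of w1 w2 "max C1 C2"])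
    show "cmod (w1 t) \<le> max C1 C2" "cmod (w2 t) \<le> max C1 C2" for t
      using solutionD(3)[OF W1, of t] solutionD(3)[OF W2, of t] by auto
    fix g assume g [measurable]: "g \<in> borel_measurable borel" and gL2: "L2 R g"
      and gJ: "\<And>t. t \<notin> ?J \<Longrightarrow> g t = 0"
      and g1: "(LINT t|R. g t * w1 t) = 0" and g2: "(LINT t|R. g t * w2 t) = 0"
    define p :: "real \<Rightarrow> complex" where "p = (\<lambda>t. of_real (d R t) * g t)"
    have mp [measurable]: "p \<in> borel_measurable borel" by (simp add: p_def)
    \<comment> \<open>The interval has finite mass, so pairing \<open>g\<close> with its
      square-integrable indicator gives integrability.\<close>
    have gR: "integrable R g"
    proof -
      have "L2 R (indicator ?J)"
        by (rule L2_bounded[OF loc(1) ab, where B=1]) (auto split: split_indicator)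
      from L2_integrable[OF gL2 this] have "integrable R (\<lambda>x. g x * cnj (indicator ?J x))" .
      also have "(\<lambda>x. g x * cnj (indicator ?J x)) = g" using gJ by (auto split: split_indicator)
      finally show ?thesis .
    qed
    have ip: "integrable M p" unfolding p_def using di(2)[of R g] gJ gR by simp
    obtain f k B where FK: "solution s q p 0 0 f k B"
      using solution_exists[OF ms mq mp ip sL qL] by blast
    note f [measurable] = solutionD(1,2)[OF FK]
    note fB = solutionD(3,4)[OF FK] and fe = solutionD(5,6)[OF FK]
    \<comment> \<open>The integral term of the Lagrange identity at \<beta> is the pairing of
      \<open>g\<close> with \<open>w\<close>.\<close>
    have pw: "cum (\<lambda>t. w t * p t) \<beta> = 0" if [measurable]: "w \<in> borel_measurable borel"
      and w: "(LINT t|R. g t * w t) = 0" for w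
    proof -
      have "cum (\<lambda>t. w t * p t) \<beta> = cum (\<lambda>t. of_real (d R t) * (g t * w t)) \<beta>"
        by (simp add: p_def mult_ac)
      also have "\<dots> = set_lebesgue_integral R {..<\<beta>} (\<lambda>t. g t * w t)"
        by (rule cd) (auto simp: gJ)
      also have "\<dots> = (LINT t|R. g t * w t)"
        unfolding set_lebesgue_integral_def using gJ
        by (intro Bochner_Integration.integral_cong) (auto split: split_indicator)
      finally show ?thesis by (simp add: w)
    qed
    have at': "measure M {t} = 0 \<or> s t * p t = 0" for t using at[of t] by (auto simp: p_def)
    have b1: "f \<beta> * l1 \<beta> = w1 \<beta> * k \<beta>"
      using lagrange_identity[OF ms mq mp ip sL qL FK W1, of \<beta>] at at' pw[OF solutionD(1)[OF W1] g1]
      by auto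
    have b2: "f \<beta> * l2 \<beta> = w2 \<beta> * k \<beta>"
      using lagrange_identity[OF ms mq mp ip sL qL FK W2, of \<beta>] at at' pw[OF solutionD(1)[OF W2] g2]
      by auto
    \<comment> \<open>Cramer's rule: \<open>b1\<close> and \<open>b2\<close> are a homogeneous
      linear system for \<open>f \<beta>\<close> and \<open>k \<beta>\<close> whose determinant is
      the Wronskian.\<close>
    have "f \<beta> = w1 \<beta> * (f \<beta> * l2 \<beta>) - w2 \<beta> * (f \<beta> * l1 \<beta>)"
      using wronskian[of \<beta>] by (metis mult.commute mult.left_commute mult.right_neutral right_diff_distrib)
    then have f\<beta>: "f \<beta> = 0" unfolding b1 b2 by (simp add: mult_ac)
    have "k \<beta> = l2 \<beta> * (w1 \<beta> * k \<beta>) - l1 \<beta> * (w2 \<beta> * k \<beta>)"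
      using wronskian[of \<beta>] by (metis mult.commute mult.left_commute mult.right_neutral right_diff_distrib)
    then have k\<beta>: "k \<beta> = 0" unfolding b1[symmetric] b2[symmetric] by (simp add: mult_ac)
    have s0: "s t * k t = 0" and q0: "q t * f t - p t = 0" if "t \<notin> ?J" for t
      using that gJ[OF that] by (auto simp: s_def q_def p_def)
    have fout: "f x = 0" and kout: "k x = 0" if "x \<le> \<alpha> \<or> \<beta> \<le> x" for x
      using that cum_outside[OF s0, where x=x] cum_outside[OF q0, where x=x] f\<beta> k\<beta>
        fe(1)[of x] fe(1)[of \<beta>] fe(2)[of x] fe(2)[of \<beta>] by auto
    have fJ: "f t = 0" and kJ: "k t = 0" if "t \<notin> ?J" for t
      using that by (auto intro!: fout kout)
    define G where "G = (\<lambda>t. g t + z * f t)"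
    have G [measurable]: "G \<in> borel_measurable borel" by (simp add: G_def)
    have GJ: "G t = 0" if "t \<notin> ?J" for t using that by (simp add: G_def gJ fJ)
    have fL2: "L2 R f"
      by (rule L2_bounded[OF loc(1) ab f(1) fB(1)]) (auto intro: fout)
    have GL2: "L2 R G" unfolding G_def by (intro L2_add L2_cmult gL2 fL2)
    have GR: "integrable R G"
    proof -
      have "set_integrable R {\<alpha>..\<beta>} f" by (rule loc_finite_integrable[OF loc(1) ab f(1) fB(1)])
      moreover have "(\<lambda>t. indicator {\<alpha>..\<beta>} t *\<^sub>R f t) = f"
        by (intro ext) (auto simp: fout split: split_indicator)
      ultimately have "integrable R f" by (simp add: set_integrable_def)
      then show ?thesis unfolding G_def using gR by auto
    qed
    have bdX: "integrable M (\<lambda>t. of_real (d X t) * h t)"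
      if "X \<in> ?I" and [measurable]: "h \<in> borel_measurable borel" and "\<And>t. cmod (h t) \<le> B" for X h
      using d0[OF that(1)] d1[OF that(1)] that d_meas[OF that(1)]
      by (intro integrable_bounded_mult[where B=1] integrable_bounded[where B=B]) auto
    have cdo: "cum (\<lambda>t. of_real (d X t) * h t) x = oint X \<alpha> x h"
      if X: "X \<in> ?I" and h: "h \<in> borel_measurable borel" "\<And>t. t \<notin> ?J \<Longrightarrow> h t = 0"
      for X x and h :: "real \<Rightarrow> complex"
    proof -
      have "oint X \<alpha> x h = set_lebesgue_integral X {..<x} h"
        by (rule oint_vanishing_left) (auto intro: h(2))
      then show ?thesis using cd[OF X X X X h] by simp
    qed
    have fcum: "f x = oint_s SP SN \<alpha> x k" for x
    proof -
      have "f x = cum (\<lambda>t. of_real (d SP t) * k t - of_real (d SN t) * k t) x"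
        unfolding fe(1)[of x] add_0 by (rule cum_cong) (auto simp: s_def kJ algebra_simps split: split_indicator)
      also have "\<dots> = cum (\<lambda>t. of_real (d SP t) * k t) x - cum (\<lambda>t. of_real (d SN t) * k t) x"
        using fB by (intro cum_diff bdX) auto
      also have "\<dots> = oint_s SP SN \<alpha> x k"
        unfolding oint_s_def by (intro arg_cong2[where f=minus] cdo) (auto simp: kJ)
      finally show ?thesis .
    qed
    have kcum: "k x = oint_s XP XN \<alpha> x f - oint R \<alpha> x G" for x
    proof -
      have 1: "integrable M (\<lambda>t. of_real (d XP t) * f t)" "integrable M (\<lambda>t. of_real (d XN t) * f t)"
        using fB by (auto intro: bdX)
      have 2: "integrable M (\<lambda>t. of_real (d R t) * G t)" using di(2)[of R G] GJ GR by simp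
      have "k x = cum (\<lambda>t. (of_real (d XP t) * f t - of_real (d XN t) * f t) - of_real (d R t) * G t) x"
        unfolding fe(2)[of x] add_0 by (rule cum_cong) (auto simp: q_def p_def G_def fJ gJ algebra_simps split: split_indicator)
      also have "\<dots> = cum (\<lambda>t. of_real (d XP t) * f t) x - cum (\<lambda>t. of_real (d XN t) * f t) x
          - cum (\<lambda>t. of_real (d R t) * G t) x"
        using 1 2 by (simp add: cum_diff)
      also have "\<dots> = oint_s XP XN \<alpha> x f - oint R \<alpha> x G"
        unfolding oint_s_def by (intro arg_cong2[where f=minus] cdo) (auto simp: fJ GJ)
      finally show ?thesis .
    qed
    have "tau_rel a b R SP SN XP XN f G"
      unfolding tau_rel_def
    proof (intro bexI[of _ \<alpha>] exI conjI)
      show "AC_signed a b SP SN \<alpha> f k"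
        unfolding AC_signed_def loc_int_def
      proof (intro conjI allI impI ballI)
        show "f x = f \<alpha> + oint_s SP SN \<alpha> x k" for x using fcum[of x] by (simp add: fout)
      qed (auto intro: loc_finite_integrable[OF _ _ _ f(2) fB(2)] loc)
      \<comment> \<open>The function \<open>F\<close> is defined from \<open>k\<close>, so the
        relation between \<open>F\<close> and the density of \<open>f\<close> holds at every point.
        What remains is that \<open>F\<close> has density \<open>G\<close>, and this is
        \<open>kcum\<close>.\<close>
      show "AC_pos a b R \<alpha> (\<lambda>x. - k x + oint_s XP XN \<alpha> x f) G"
        unfolding AC_pos_def loc_int_def
      proof (intro conjI allI impI ballI)
        show "set_integrable R {x..y} G" for x y
          unfolding set_integrable_def using sets[of R] by (intro integrable_mult_indicator GR) auto
        show "- k x + oint_s XP XN \<alpha> x f = - k \<alpha> + oint_s XP XN \<alpha> \<alpha> f + oint R \<alpha> x G" for x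
          using kcum[of x] by (simp add: kout) (simp add: oint_s_def oint_def)
      qed
    qed (use ab in auto)
    moreover have "f x = 0" if "x \<notin> {\<alpha>..\<beta>}" for x using that by (intro fout) auto
    ultimately have "(f, G) \<in> T0 a b R SP SN XP XN"
      unfolding T0_def Tmax_def mem_Collect_eq split_conv using fL2 GL2 ab by blast
    then show "\<exists>f. (f, \<lambda>t. g t + z * f t) \<in> T0 a b R SP SN XP XN" unfolding G_def by blast
  qed (use solutionD(1)[OF W1] solutionD(1)[OF W2] in auto)
qed

section \<open>Conjugation and the orthogonal complement\<close>

text \<open>The coefficient measures are real, so conjugation passes through every integral; the
  conjugates of \<open>h\<close> and \<open>F\<close> are the witnesses.\<close>

lemma tau_rel_cnj:
  assumes "tau_rel a b R SP SN XP XN f g"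
  shows "tau_rel a b R SP SN XP XN (\<lambda>x. cnj (f x)) (\<lambda>x. cnj (g x))"
proof -
  have oc: "oint M c x (\<lambda>t. cnj (h t)) = cnj (oint M c x h)" for M c x h
  proof -
    have "set_lebesgue_integral M A (\<lambda>t. cnj (h t)) = cnj (set_lebesgue_integral M A h)" for A
      unfolding set_lebesgue_integral_def Bochner_Integration.integral_cnj[symmetric] by simp
    then show ?thesis by (simp add: oint_def)
  qed
  have osc: "oint_s P N c x (\<lambda>t. cnj (h t)) = cnj (oint_s P N c x h)" for P N c x h
    by (simp add: oint_s_def oc)
  have lc: "loc_int a b M (\<lambda>t. cnj (h t))" if "loc_int a b M h" for M h
    using that by (simp add: loc_int_def set_integrable_def flip: complex_cnj_scaleR)
  from assms obtain c h F where c: "c \<in> Iab a b" and "AC_signed a b SP SN c f h" "AC_pos a b R c F g"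
    and ae: "AE x in SP. x \<in> Iab a b \<longrightarrow> F x = - h x + oint_s XP XN c x f"
      "AE x in SN. x \<in> Iab a b \<longrightarrow> F x = - h x + oint_s XP XN c x f"
    unfolding tau_rel_def by blast
  then have "AC_signed a b SP SN c (\<lambda>x. cnj (f x)) (\<lambda>x. cnj (h x))"
    "AC_pos a b R c (\<lambda>x. cnj (F x)) (\<lambda>x. cnj (g x))"
    unfolding AC_signed_def AC_pos_def oc osc complex_cnj_add[symmetric] complex_cnj_cancel_iff
    by (blast intro: lc)+
  moreover have "AE x in SP. x \<in> Iab a b \<longrightarrow> cnj (F x) = - cnj (h x) + oint_s XP XN c x (\<lambda>x. cnj (f x))"
    using ae(1) by eventually_elim (simp add: osc)
  moreover have "AE x in SN. x \<in> Iab a b \<longrightarrow> cnj (F x) = - cnj (h x) + oint_s XP XN c x (\<lambda>x. cnj (f x))"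
    using ae(2) by eventually_elim (simp add: osc)
  ultimately show ?thesis
    unfolding tau_rel_def using c
    by (intro bexI[of _ c] exI[of _ "\<lambda>x. cnj (h x)"] exI[of _ "\<lambda>x. cnj (F x)"]) auto
qed

lemma T0_cnj:
  "(f, g) \<in> T0 a b R SP SN XP XN \<Longrightarrow> (\<lambda>x. cnj (f x), \<lambda>x. cnj (g x)) \<in> T0 a b R SP SN XP XN"
  by (auto simp: T0_def Tmax_def tau_rel_cnj L2_cnj)

lemma Tmin_cnj:
  assumes "(f, g) \<in> Tmin a b R SP SN XP XN"
  shows "(\<lambda>x. cnj (f x), \<lambda>x. cnj (g x)) \<in> Tmin a b R SP SN XP XN"
proof -
  from assms obtain fg where L: "L2 R f" "L2 R g" and fg: "\<And>n. fg n \<in> T0 a b R SP SN XP XN"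
    and lim: "(\<lambda>n. l2norm R (\<lambda>x. fst (fg n) x - f x)) \<longlonglongrightarrow> 0"
      "(\<lambda>n. l2norm R (\<lambda>x. snd (fg n) x - g x)) \<longlonglongrightarrow> 0"
    unfolding Tmin_def l2closure_def by auto
  let ?fg = "\<lambda>n. (\<lambda>x. cnj (fst (fg n) x), \<lambda>x. cnj (snd (fg n) x))"
  have "l2norm R (\<lambda>x. cnj (u x) - cnj (v x)) = l2norm R (\<lambda>x. u x - v x)" for u v
    unfolding l2norm_def by (simp flip: complex_cnj_diff)
  moreover have "?fg n \<in> T0 a b R SP SN XP XN" for n
    using fg[of n] by (intro T0_cnj) simp
  ultimately show ?thesis
    unfolding Tmin_def l2closure_def using L lim by (auto intro!: L2_cnj exI[of _ ?fg])
qed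

lemma T0_subset_Tmin: "T0 a b R SP SN XP XN \<subseteq> Tmin a b R SP SN XP XN"
proof (rule subrelI)
  fix f g assume fg: "(f, g) \<in> T0 a b R SP SN XP XN"
  then have "L2 R f" "L2 R g" by (auto simp: T0_def Tmax_def)
  with fg show "(f, g) \<in> Tmin a b R SP SN XP XN"
    unfolding Tmin_def l2closure_def by (auto simp: l2norm_def intro!: exI[of _ "\<lambda>_. (f, g)"])
qed

lemma ran_shiftI: "(f, g) \<in> T \<Longrightarrow> (\<lambda>x. g x - z * f x) \<in> ran_shift T z"
  by (auto simp: ran_shift_def)

text \<open>Conjugation leaves \<open>Tmin\<close> invariant, hence exchanges the ranges belonging
  to \<open>z\<close> and \<open>cnj z\<close>, and it conjugates inner products.\<close>

lemma l2orth_cnj: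
  assumes "u \<in> l2orth R (ran_shift (Tmin a b R SP SN XP XN) z)"
  shows "(\<lambda>x. cnj (u x)) \<in> l2orth R (ran_shift (Tmin a b R SP SN XP XN) (cnj z))"
  unfolding l2orth_def
proof (intro CollectI conjI ballI)
  show "L2 R (\<lambda>x. cnj (u x))" using assms by (auto simp: l2orth_def intro: L2_cnj)
  fix v assume "v \<in> ran_shift (Tmin a b R SP SN XP XN) (cnj z)"
  then obtain f g where fg: "(f, g) \<in> Tmin a b R SP SN XP XN" and v: "v = (\<lambda>x. g x - cnj z * f x)"
    by (auto simp: ran_shift_def)
  from Tmin_cnj[OF fg] have "(\<lambda>x. cnj (v x)) \<in> ran_shift (Tmin a b R SP SN XP XN) z"
    unfolding ran_shift_def v by force
  then have "l2inner R (\<lambda>x. cnj (v x)) u = 0" using assms by (auto simp: l2orth_def)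
  moreover have "l2inner R v (\<lambda>x. cnj (u x)) = cnj (l2inner R (\<lambda>x. cnj (v x)) u)"
    unfolding l2inner_def Bochner_Integration.integral_cnj[symmetric] by simp
  ultimately show "l2inner R v (\<lambda>x. cnj (u x)) = 0" by simp
qed

text \<open>A linear relation between conjugated functions can be conjugated back, so independence
  is preserved. Equality of dimensions follows by using this in both directions.\<close>

lemma l2dim_cnj_le:
  assumes "\<And>u. u \<in> S \<Longrightarrow> (\<lambda>x. cnj (u x)) \<in> S'"
  shows "l2dim M S \<le> l2dim M S'"
  unfolding l2dim_def
proof (rule Sup_subset_mono, safe)
  fix n and us :: "nat \<Rightarrow> real \<Rightarrow> complex"
  assume us: "\<forall>i<n. us i \<in> S"
    and ind: "\<forall>c. (AE x in M. (\<Sum>i<n. c i * us i x) = 0) \<longrightarrow> (\<forall>i<n. c i = 0)"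
  have "\<forall>i<n. c i = 0" if ae: "AE x in M. (\<Sum>i<n. c i * cnj (us i x)) = 0" for c
  proof -
    have "AE x in M. (\<Sum>i<n. cnj (c i) * us i x) = 0"
      using ae
    proof eventually_elim
      case (elim x)
      have "(\<Sum>i<n. cnj (c i) * us i x) = cnj (\<Sum>i<n. c i * cnj (us i x))" by simp
      with elim show ?case by simp
    qed
    with ind[rule_format, of "\<lambda>i. cnj (c i)"] show ?thesis by simp
  qed
  then show "\<exists>m. enat n = enat m \<and> (\<exists>us. (\<forall>i<m. us i \<in> S') \<and>
      (\<forall>c. (AE x in M. (\<Sum>i<m. c i * us i x) = 0) \<longrightarrow> (\<forall>i<m. c i = 0)))"
    using us assms by (intro exI[of _ n] conjI refl exI[of _ "\<lambda>i x. cnj (us i x)"]) auto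
qed

lemma defect_cnj: "defect R (Tmin a b R SP SN XP XN) (cnj z) = defect R (Tmin a b R SP SN XP XN) z"
  unfolding defect_def
  using l2orth_cnj[of _ R a b SP SN XP XN z] l2orth_cnj[of _ R a b SP SN XP XN "cnj z"]
  by (intro antisym l2dim_cnj_le) auto

text \<open>Let \<open>g\<close> be \<open>u\<close> on the interval minus its projection onto the
  conjugates of the fundamental system. Then \<open>g\<close> is an admissible right-hand side, lies
  in the range and is orthogonal to \<open>u\<close>; being orthogonal also to what was subtracted,
  it is orthogonal to itself.\<close>

proposition orth_locally_two_dim:
  fixes R SP SN XP XN :: "real measure" and z :: complex
  assumes loc: "loc_finite a b R" "loc_finite a b SP" "loc_finite a b SN"
      "loc_finite a b XP" "loc_finite a b XN"
    and atoms: "\<And>x. x \<in> Iab a b \<Longrightarrow>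
        (measure SP {x} - measure SN {x}) * (measure XP {x} - measure XN {x}) = 0 \<and>
        (measure SP {x} - measure SN {x}) * measure R {x} = 0"
    and ab: "\<alpha> \<in> Iab a b" "\<beta> \<in> Iab a b"
  shows "\<exists>v w. \<forall>u \<in> l2orth R (ran_shift (Tmin a b R SP SN XP XN) z).
      \<exists>c d. AE x in R. x \<in> {\<alpha>..<\<beta>} \<longrightarrow> u x = c * v x + d * w x"
proof -
  let ?T = "Tmin a b R SP SN XP XN" and ?J = "{\<alpha>..<\<beta>}"
  have sets: "sets R = sets borel" using loc(1) by (simp add: loc_finite_def)
  show ?thesis
  proof (rule compact_test_functions[OF loc atoms ab, where z = z])
    fix w1 w2 C assume w [measurable]: "w1 \<in> borel_measurable borel" "w2 \<in> borel_measurable borel"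
      and wC: "\<And>t. cmod (w1 t) \<le> C" "\<And>t. cmod (w2 t) \<le> C"
      and test: "\<And>g. \<lbrakk>g \<in> borel_measurable borel; L2 R g; \<And>t. t \<notin> ?J \<Longrightarrow> g t = 0;
       (LINT t|R. g t * w1 t) = 0; (LINT t|R. g t * w2 t) = 0\<rbrakk>
       \<Longrightarrow> \<exists>f. (f, \<lambda>t. g t + z * f t) \<in> T0 a b R SP SN XP XN"
    \<comment> \<open>\<open>l2inner\<close> conjugates its second argument while the conditions on
      test functions do not; the conjugates reconcile the two.\<close>
    define v where "v = (\<lambda>t. indicator ?J t * cnj (w1 t))"
    define w where "w = (\<lambda>t. indicator ?J t * cnj (w2 t))"
    have mv [measurable]: "v \<in> borel_measurable borel" "w \<in> borel_measurable borel"
      unfolding v_def w_def by measurable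
    have C0: "0 \<le> C" using wC(1)[of 0] norm_ge_zero order_trans by blast
    have vL2: "L2 R v"
      by (rule L2_bounded[OF loc(1) ab mv(1), where B=C])
         (auto simp: v_def wC C0 split: split_indicator)
    have wL2: "L2 R w"
      by (rule L2_bounded[OF loc(1) ab mv(2), where B=C])
         (auto simp: w_def wC C0 split: split_indicator)
    have "\<exists>c d. AE x in R. x \<in> ?J \<longrightarrow> u x = c * v x + d * w x"
      if u: "u \<in> l2orth R (ran_shift ?T z)" for u
    proof -
      have uL2: "L2 R u" using u by (simp add: l2orth_def)
      define u' where "u' = (\<lambda>x. indicator ?J x * u x)"
      have u'L2: "L2 R u'" unfolding u'_def by (rule L2_indicator[OF uL2]) (simp add: sets)
      obtain c d where cd: "l2inner R (\<lambda>x. u' x - (c * v x + d * w x)) v = 0"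
        "l2inner R (\<lambda>x. u' x - (c * v x + d * w x)) w = 0"
        by (rule l2_project2[OF u'L2 vL2 wL2]) (rule that)
      define g where "g = (\<lambda>x. u' x - (c * v x + d * w x))"
      have gL2: "L2 R g" unfolding g_def by (intro L2_diff L2_add L2_cmult u'L2 vL2 wL2)
      have gJ: "g t = 0" if "t \<notin> ?J" for t using that by (simp add: g_def u'_def v_def w_def)
      have gv: "(\<lambda>t. g t * w1 t) = (\<lambda>t. g t * cnj (v t))" "(\<lambda>t. g t * w2 t) = (\<lambda>t. g t * cnj (w t))"
        using gJ by (auto simp: fun_eq_iff v_def w_def split: split_indicator)
      have "g \<in> borel_measurable borel"
        using gL2 sets by (simp add: L2_def cong: measurable_cong_sets)
      moreover have "(LINT t|R. g t * w1 t) = 0" "(LINT t|R. g t * w2 t) = 0"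
        unfolding gv using cd by (simp_all only: l2inner_def g_def)
      ultimately obtain f where "(f, \<lambda>t. g t + z * f t) \<in> T0 a b R SP SN XP XN"
        using test[OF _ gL2 gJ] by blast
      then have "(f, \<lambda>t. g t + z * f t) \<in> ?T" using T0_subset_Tmin by blast
      from ran_shiftI[OF this] have "(\<lambda>t. (g t + z * f t) - z * f t) \<in> ran_shift ?T z" .
      then have "l2inner R g u = 0" using u by (simp add: l2orth_def)
      moreover have "l2inner R g u = l2inner R g u'"
        unfolding l2inner_def u'_def using gJ
        by (intro Bochner_Integration.integral_cong) (auto split: split_indicator)
      moreover have "l2inner R g g = l2inner R g u' - (cnj c * l2inner R g v + cnj d * l2inner R g w)"
      proof -
        have "l2inner R g g = l2inner R g (\<lambda>x. (u' x - c * v x) - d * w x)"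
          by (simp add: g_def algebra_simps)
        also have "\<dots> = l2inner R g u' - (cnj c * l2inner R g v + cnj d * l2inner R g w)"
          using gL2 u'L2 vL2 wL2 by (simp add: l2inner_diff_right L2_diff L2_cmult l2inner_cmult_right)
        finally show ?thesis .
      qed
      \<comment> \<open>All three terms vanish: the first because \<open>g\<close> belongs to the
        range, the other two by the choice of the projection.\<close>
      ultimately have "l2inner R g g = 0" using cd by (simp flip: g_def)
      from l2inner_self_0[OF gL2 this] have "AE x in R. x \<in> ?J \<longrightarrow> u x = c * v x + d * w x"
        by eventually_elim (auto simp: g_def u'_def)
      then show ?thesis by blast
    qed
    then show ?thesis by blast
  qed
qed

section \<open>Linear dependence of three functions, locally and globally\<close>

lemma orthogonal_to_pair_in_C3:
  fixes c0 c1 c2 d0 d1 d2 :: complex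
  shows "\<exists>x y z. (x \<noteq> 0 \<or> y \<noteq> 0 \<or> z \<noteq> 0) \<and>
    x * c0 + y * c1 + z * c2 = 0 \<and> x * d0 + y * d1 + z * d2 = 0"
proof -
  have single: "\<exists>x y z. (x \<noteq> 0 \<or> y \<noteq> 0 \<or> z \<noteq> 0) \<and> x * p + y * q + z * r = 0" for p q r :: complex
  proof (cases "p = 0 \<and> q = 0")
    case True
    then show ?thesis by (intro exI[of _ 1] exI[of _ 0]) simp
  next
    case False
    then show ?thesis by (intro exI[of _ q] exI[of _ "- p"] exI[of _ 0]) (auto simp: mult.commute)
  qed
  \<comment> \<open>The cross product of the two vectors annihilates both; it vanishes only if they
    are parallel.\<close>
  let ?x = "c1 * d2 - c2 * d1" and ?y = "c2 * d0 - c0 * d2" and ?z = "c0 * d1 - c1 * d0"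
  show ?thesis
  proof (cases "?x = 0 \<and> ?y = 0 \<and> ?z = 0")
    case False
    then show ?thesis
      by (intro exI[of _ ?x] exI[of _ ?y] exI[of _ ?z]) (auto simp: algebra_simps)
  next
    case par: True
    show ?thesis
    proof (cases "c0 = 0 \<and> c1 = 0 \<and> c2 = 0")
      case True
      then show ?thesis using single[of "d0" "d1" "d2"] by simp
    next
      case False
      obtain x y z where xyz: "x \<noteq> 0 \<or> y \<noteq> 0 \<or> z \<noteq> 0" and o: "x * c0 + y * c1 + z * c2 = 0"
        using single by blast
      let ?s = "x * d0 + y * d1 + z * d2"
      \<comment> \<open>For parallel vectors a solution of the first equation solves the second:
        multiplied by each \<open>c\<close> coordinate, the second form becomes a multiple of the
        first, and some coordinate is nonzero.\<close>
      have "c0 * ?s = d0 * (x * c0 + y * c1 + z * c2)" "c1 * ?s = d1 * (x * c0 + y * c1 + z * c2)"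
        "c2 * ?s = d2 * (x * c0 + y * c1 + z * c2)"
        using par by algebra+
      then have "?s = 0" using False unfolding o by auto
      then show ?thesis using xyz o by blast
    qed
  qed
qed

text \<open>The local coefficient vectors may depend on the interval; a limit point of the normalised ones,
  which exists by compactness of the unit sphere, works globally.\<close>

lemma dependent_of_locally_dependent:
  fixes u0 u1 u2 :: "'x \<Rightarrow> complex" and J :: "nat \<Rightarrow> 'x set"
  assumes dep: "\<And>n. \<exists>a0 a1 a2. (a0 \<noteq> 0 \<or> a1 \<noteq> 0 \<or> a2 \<noteq> 0) \<and>
      (AE x in M. x \<in> J n \<longrightarrow> a0 * u0 x + a1 * u1 x + a2 * u2 x = 0)"
    and J: "incseq J" and cover: "AE x in M. x \<in> (\<Union>n. J n)"
  shows "\<exists>a0 a1 a2. (a0 \<noteq> 0 \<or> a1 \<noteq> 0 \<or> a2 \<noteq> 0) \<and> (AE x in M. a0 * u0 x + a1 * u1 x + a2 * u2 x = 0)"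
proof -
  define F where "F = (\<lambda>(a :: complex \<times> complex \<times> complex) x. fst a * u0 x + fst (snd a) * u1 x + snd (snd a) * u2 x)"
  have "\<exists>a. norm a = 1 \<and> (AE x in M. x \<in> J n \<longrightarrow> F a x = 0)" for n
  proof -
    obtain a0 a1 a2 where nz: "a0 \<noteq> 0 \<or> a1 \<noteq> 0 \<or> a2 \<noteq> 0"
      and ae: "AE x in M. x \<in> J n \<longrightarrow> a0 * u0 x + a1 * u1 x + a2 * u2 x = 0" using dep by blast
    let ?a = "(a0, a1, a2)"
    have "?a \<noteq> 0" using nz by (auto simp: zero_prod_def)
    then have "norm (?a /\<^sub>R norm ?a) = 1" by (metis norm_sgn sgn_div_norm)
    moreover have "F (?a /\<^sub>R norm ?a) x = (a0 * u0 x + a1 * u1 x + a2 * u2 x) /\<^sub>R norm ?a" for x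
      by (simp add: F_def scaleR_add_right)
    then have "AE x in M. x \<in> J n \<longrightarrow> F (?a /\<^sub>R norm ?a) x = 0" using ae by auto
    ultimately show ?thesis by blast
  qed
  then obtain a where a1: "\<And>n. norm (a n) = 1" and ae: "\<And>n. AE x in M. x \<in> J n \<longrightarrow> F (a n) x = 0"
    by metis
  have "compact (sphere (0 :: complex \<times> complex \<times> complex) 1)" by (rule compact_sphere)
  moreover have "\<forall>n. a n \<in> sphere 0 1" using a1 by simp
  ultimately obtain l r where l: "l \<in> sphere 0 1" and r: "strict_mono (r :: nat \<Rightarrow> nat)"
    and lim: "(a \<circ> r) \<longlonglongrightarrow> l"
    unfolding compact_def by metis
  \<comment> \<open>Countably many exceptional null sets are merged into one that serves every
    \<open>n\<close>.\<close>
  have "AE x in M. \<forall>n. x \<in> J n \<longrightarrow> F (a n) x = 0" using ae by (simp add: AE_all_countable)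
  with cover have "AE x in M. F l x = 0"
  proof eventually_elim
    case (elim x)
    then obtain m where m: "x \<in> J m" by blast
    \<comment> \<open>Since the sets increase and \<open>r n \<ge> n\<close>, a point of
      \<open>J m\<close> lies in all later sets; the values are zero from \<open>m\<close> on, and
      continuity in the coefficients carries this to the limit.\<close>
    have "F ((a \<circ> r) n) x = 0" if "n \<ge> m" for n
    proof -
      have "m \<le> r n" using that seq_suble[OF r, of n] by linarith
      with m J have "x \<in> J (r n)" by (auto simp: incseq_def)
      with elim show ?thesis by simp
    qed
    then have "(\<lambda>n. F ((a \<circ> r) n) x) \<longlonglongrightarrow> 0"
      by (intro tendsto_eventually eventually_sequentiallyI[of m]) auto
    moreover have "(\<lambda>n. F ((a \<circ> r) n) x) \<longlonglongrightarrow> F l x"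
      unfolding F_def by (intro tendsto_intros lim)
    ultimately show ?case using LIMSEQ_unique by blast
  qed
  moreover have "fst l \<noteq> 0 \<or> fst (snd l) \<noteq> 0 \<or> snd (snd l) \<noteq> 0"
    using l by (auto simp: prod_eq_iff norm_prod_def)
  ultimately show ?thesis unfolding F_def by blast
qed

lemma l2dim_le_2:
  assumes dep: "\<And>u0 u1 u2. \<lbrakk>u0 \<in> S; u1 \<in> S; u2 \<in> S\<rbrakk> \<Longrightarrow>
      \<exists>a0 a1 a2. (a0 \<noteq> 0 \<or> a1 \<noteq> 0 \<or> a2 \<noteq> 0) \<and> (AE x in M. a0 * u0 x + a1 * u1 x + a2 * u2 x = 0)"
  shows "l2dim M S \<le> 2"
  unfolding l2dim_def
proof (rule Sup_least, safe)
  fix n and us :: "nat \<Rightarrow> real \<Rightarrow> complex"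
  assume us: "\<forall>i<n. us i \<in> S"
    and ind: "\<forall>c. (AE x in M. (\<Sum>i<n. c i * us i x) = 0) \<longrightarrow> (\<forall>i<n. c i = 0)"
  have "n \<le> 2"
  proof (rule ccontr)
    assume "\<not> n \<le> 2"
    then have n: "3 \<le> n" by simp
    obtain a0 a1 a2 where nz: "a0 \<noteq> 0 \<or> a1 \<noteq> 0 \<or> a2 \<noteq> 0"
      and ae: "AE x in M. a0 * us 0 x + a1 * us 1 x + a2 * us 2 x = 0"
      using dep[of "us 0" "us 1" "us 2"] us n by auto
    \<comment> \<open>The dependence among the first three members, padded with zeros to the whole
      family.\<close>
    define c where "c = (\<lambda>i::nat. if i = 0 then a0 else if i = 1 then a1 else if i = 2 then a2 else 0)"
    have "(\<Sum>i<n. c i * us i x) = a0 * us 0 x + a1 * us 1 x + a2 * us 2 x" for x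
    proof -
      have "(\<Sum>i<n. c i * us i x) = (\<Sum>i<3. c i * us i x)"
        using n by (intro sum.mono_neutral_right) (auto simp: c_def)
      then show ?thesis by (simp add: c_def numeral_3_eq_3 numeral_2_eq_2)
    qed
    with ae have "AE x in M. (\<Sum>i<n. c i * us i x) = 0" by simp
    with ind have "\<forall>i<n. c i = 0" by blast
    then have "c 0 = 0" "c 1 = 0" "c 2 = 0" using n by auto
    with nz show False by (auto simp: c_def)
  qed
  then show "enat n \<le> 2" by (simp add: numeral_eq_enat)
qed

theorem theorem4p9:
  fixes a b :: ereal and R SP SN XP XN :: "real measure"
  assumes ab: "a < b"
    and H1: "loc_finite a b R"
    and H2: "signed_lf a b XP XN"
    and H3: "signed_lf a b SP SN" "supp_signed a b SP SN = Iab a b"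
    and H4: "\<forall>x \<in> Iab a b.
        (measure SP {x} - measure SN {x}) * (measure XP {x} - measure XN {x}) = 0 \<and>
        (measure SP {x} - measure SN {x}) * measure R {x} = 0"
    and H5: "\<forall>\<alpha> \<beta>. \<alpha> \<in> supp_pos a b R \<and> \<beta> \<in> supp_pos a b R \<and> \<alpha> < \<beta> \<and>
                 {\<alpha><..<\<beta>} \<inter> supp_pos a b R = {} \<longrightarrow>
               (\<forall>f. in_Dtau a b R SP SN XP XN f \<and> (f \<longlongrightarrow> 0) (at_left \<alpha>) \<and> (f \<longlongrightarrow> 0) (at_right \<beta>)
                    \<longrightarrow> (\<forall>x \<in> {\<alpha><..<\<beta>}. f x = 0))"
    and H6: "\<exists>x \<in> supp_pos a b R. \<exists>y \<in> supp_pos a b R. x \<noteq> y"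
  shows "defect R (Tmin a b R SP SN XP XN) \<i> = defect R (Tmin a b R SP SN XP XN) (- \<i>)
         \<and> defect R (Tmin a b R SP SN XP XN) \<i> \<le> 2"
proof
  let ?T = "Tmin a b R SP SN XP XN"
  show "defect R ?T \<i> = defect R ?T (- \<i>)"
    using defect_cnj[of R a b SP SN XP XN "\<i>"] by simp
  have loc: "loc_finite a b R" "loc_finite a b SP" "loc_finite a b SN" "loc_finite a b XP" "loc_finite a b XN"
    using H1 H2 H3 by (auto simp: signed_lf_def)
  \<comment> \<open>Increasing compact intervals that exhaust \<open>(a,b)\<close>, for finite and
    infinite end points alike.\<close>
  obtain u l :: "nat \<Rightarrow> real" where cover: "einterval a b = (\<Union>i. {l i .. u i})"
    and mono: "incseq u" "decseq l" and lu: "\<And>i. l i < u i" and in_ab: "\<And>i. a < l i" "\<And>i. u i < b"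
    by (rule einterval_Icc_approximation[OF ab]) (rule that)
  show "defect R ?T \<i> \<le> 2"
    unfolding defect_def
  proof (rule l2dim_le_2, rule dependent_of_locally_dependent)
    let ?S = "l2orth R (ran_shift ?T \<i>)"
    fix u0 u1 u2 assume S: "u0 \<in> ?S" "u1 \<in> ?S" "u2 \<in> ?S"
    show "incseq (\<lambda>i. {l i .. u i})"
      using mono unfolding incseq_def decseq_def by (auto intro: order_trans)
    have "emeasure R (UNIV - einterval a b) = 0" "sets R = sets borel"
      using H1 by (simp_all add: loc_finite_def Iab_def einterval_def)
    then have "UNIV - einterval a b \<in> null_sets R" by (intro null_setsI) auto
    from AE_not_in[OF this] show "AE x in R. x \<in> (\<Union>i. {l i .. u i})"
      unfolding cover by simp
    show "\<exists>a0 a1 a2. (a0 \<noteq> 0 \<or> a1 \<noteq> 0 \<or> a2 \<noteq> 0) \<and>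
        (AE x in R. x \<in> {l n .. u n} \<longrightarrow> a0 * u0 x + a1 * u1 x + a2 * u2 x = 0)" for n
    proof -
      \<comment> \<open>The local result concerns half-open intervals; a right end beyond
        \<open>u n\<close> makes sure that a possible atom at \<open>u n\<close> is covered.\<close>
      obtain \<beta> :: real where \<beta>: "u n < \<beta>" "ereal \<beta> < b"
        using ereal_dense2[OF in_ab(2)[of n]] by auto
      have l\<beta>: "l n < \<beta>" using lu[of n] \<beta>(1) by simp
      have mem: "l n \<in> Iab a b" "\<beta> \<in> Iab a b"
        using in_ab(1)[of n] l\<beta> \<beta> unfolding Iab_def
        by (auto intro: less_trans[of a "ereal (l n)"] less_trans[of _ "ereal \<beta>" b])
      obtain v w where vw: "\<forall>u \<in> ?S. \<exists>c d. AE x in R. x \<in> {l n..<\<beta>} \<longrightarrow> u x = c * v x + d * w x"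
        using orth_locally_two_dim[OF loc _ mem] H4 by blast
      obtain c0 d0 c1 d1 c2 d2 where
        cd: "AE x in R. x \<in> {l n..<\<beta>} \<longrightarrow> u0 x = c0 * v x + d0 * w x"
        "AE x in R. x \<in> {l n..<\<beta>} \<longrightarrow> u1 x = c1 * v x + d1 * w x"
        "AE x in R. x \<in> {l n..<\<beta>} \<longrightarrow> u2 x = c2 * v x + d2 * w x"
        using vw S by meson
      \<comment> \<open>Relative to \<open>v\<close> and \<open>w\<close> the three functions have
        coefficient vectors in C^2, so a nontrivial combination annihilates both
        coordinates.\<close>
      obtain e0 e1 e2 where nz: "e0 \<noteq> 0 \<or> e1 \<noteq> 0 \<or> e2 \<noteq> 0"
        and e: "e0 * c0 + e1 * c1 + e2 * c2 = 0" "e0 * d0 + e1 * d1 + e2 * d2 = 0"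
        using orthogonal_to_pair_in_C3[of c0 c1 c2 d0 d1 d2] by blast
      have "AE x in R. x \<in> {l n .. u n} \<longrightarrow> e0 * u0 x + e1 * u1 x + e2 * u2 x = 0"
        using cd
      proof eventually_elim
        case (elim x)
        show ?case
        proof
          assume "x \<in> {l n .. u n}"
          with \<beta> elim have "e0 * u0 x + e1 * u1 x + e2 * u2 x
            = v x * (e0 * c0 + e1 * c1 + e2 * c2) + w x * (e0 * d0 + e1 * d1 + e2 * d2)"
            by (simp add: algebra_simps)
          then show "e0 * u0 x + e1 * u1 x + e2 * u2 x = 0" by (simp add: e)
        qed
      qed
      with nz show ?thesis by blast
    qed
  qed
qed

end
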